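(* For every integer $k\ge 4$, $\tilde{r}(P_3,P_3,C_{4k}) \le 6k+1$.
   Context: $P_m$ denotes the path and $C_m$ the cycle on $m$ vertices. The three-color online Ramsey game for graphs $G_1,G_2,G_3$ is played by Builder and Painter on an infinite vertex set with initially no edges. In each round Builder draws an edge between two currently nonadjacent vertices, and Painter immediately colors it red, blue or green. Builder wins once the colored graph contains a red copy of $G_1$, a blue copy of $G_2$, or a green copy of $G_3$. The online Ramsey number $\tilde{r}(G_1,G_2,G_3)$ is the minimum number of rounds within which Builder can guarantee a win against every strategy of Painter. *)

theory Defs
  imports Main "HOL-Library.Extended_Nat"
begin

type_synonym 'a sgraph = "'a set \<times> 'a set set"

definition path_graph :: "nat \<Rightarrow> nat sgraph" where
  "path_graph m = ({..<m}, {{i, Suc i} | i. Suc i < m})"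

text \<open>A cycle in the graph-theoretic sense only for \<open>m \<ge> 3\<close>.\<close>

definition cycle_graph :: "nat \<Rightarrow> nat sgraph" where
  "cycle_graph m = ({..<m}, {{i, Suc i mod m} | i. i < m})"

text \<open>Copies are subgraphs, not necessarily induced. The host graph is given by its edge set
  only, since its vertex set is always the whole type.\<close>

definition contains_copy :: "'v set set \<Rightarrow> 'a sgraph \<Rightarrow> bool" where
  "contains_copy E G \<longleftrightarrow>
     (\<exists>f. inj_on f (fst G) \<and> (\<forall>e \<in> snd G. f ` e \<in> E))"

datatype color = Red | Blue | Green

text \<open>The board is the infinite vertex set \<^typ>\<open>nat\<close>. A history lists the edges drawn so far,
  in order, each with the colour it received.\<close>

type_synonym history = "(nat set \<times> color) list"

type_synonym builder = "history \<Rightarrow> nat set"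

type_synonym painter = "history \<Rightarrow> nat set \<Rightarrow> color"

definition color_class :: "history \<Rightarrow> color \<Rightarrow> nat set set" where
  "color_class h c = {e. (e, c) \<in> set h}"

definition legal_move :: "history \<Rightarrow> nat set \<Rightarrow> bool" where
  "legal_move h e \<longleftrightarrow> (\<exists>u v. u \<noteq> v \<and> e = {u, v}) \<and> e \<notin> fst ` set h"

text \<open>Legality is demanded on every history, reachable or not. This costs Builder nothing:
  a history is finite and the board infinite, so a legal move always exists.\<close>

definition legal_builder :: "builder \<Rightarrow> bool" where
  "legal_builder \<sigma> \<longleftrightarrow> (\<forall>h. legal_move h (\<sigma> h))"

primrec play :: "builder \<Rightarrow> painter \<Rightarrow> nat \<Rightarrow> history" where
  "play \<sigma> \<tau> 0 = []"
| "play \<sigma> \<tau> (Suc n) =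
     (let h = play \<sigma> \<tau> n; e = \<sigma> h in h @ [(e, \<tau> h e)])"

definition builder_won :: "'a sgraph \<Rightarrow> 'b sgraph \<Rightarrow> 'c sgraph \<Rightarrow> history \<Rightarrow> bool" where
  "builder_won G1 G2 G3 h \<longleftrightarrow>
     contains_copy (color_class h Red) G1 \<or>
     contains_copy (color_class h Blue) G2 \<or>
     contains_copy (color_class h Green) G3"

definition builder_can_win_within ::
    "'a sgraph \<Rightarrow> 'b sgraph \<Rightarrow> 'c sgraph \<Rightarrow> nat \<Rightarrow> bool" where
  "builder_can_win_within G1 G2 G3 n \<longleftrightarrow>
     (\<exists>\<sigma>. legal_builder \<sigma> \<and>
        (\<forall>\<tau>. \<exists>m\<le>n. builder_won G1 G2 G3 (play \<sigma> \<tau> m)))"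

text \<open>The infimum is a minimum when Builder can force a win in boundedly many rounds,
  and \<open>\<infinity>\<close> otherwise.\<close>

definition online_ramsey3 :: "'a sgraph \<Rightarrow> 'b sgraph \<Rightarrow> 'c sgraph \<Rightarrow> enat" where
  "online_ramsey3 G1 G2 G3 = Inf {enat n | n. builder_can_win_within G1 G2 G3 n}"

end

theory Submission
  imports Defs "HOL-Library.Infinite_Typeclass"
begin

text \<open>
  Painter loses as soon as two red or two blue edges meet, so an edge is forced to be green if one
  end is already incident with both red and blue (a saturated vertex), or if one end is incident
  with red and the other one with blue. Beyond the \<open>4k\<close> edges of the green cycle Builder may spend
  \<open>2k + 1\<close> edges, hence each wasted edge has to pay for two edges of the cycle.

  Builder repeatedly plays on three fresh vertices. Up to symmetry this yields (i) a saturated vertex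
  and a green edge with one end at red and the other end at blue, for two wasted edges; (ii) a green
  path with two edges and both ends at the same colour, for one wasted edge; or (iii) a green path
  with two edges and no waste. These pieces are linked to one long green path by forced edges, or by
  edges which saturate their ends when they are not green, while the saturated vertices are strung
  together, with fresh vertices in between, to a second green path with saturated ends.
  Two forced edges finally join the two paths to a cycle of the exact length.
\<close>

section \<open>Positions\<close>

text \<open>The budget \<open>6k + 1\<close> is 3N/2 + 1 for N = 4k, and after each kind of opening
  piece the remaining moves meet the required bound with equality, so every later step has to pay
  for itself. To avoid fractions, moves are counted twice: a missing vertex or edge is worth 3, a
  move costs 2, and an additive constant records which colours lie at the ends of the long path.
  That constant is needed since a piece with both ends of colour e is in general linked by a forced
  edge only at an end of the other colour. Once a saturated vertex is available
  (\<open>rich\<close>), different end colours are the good state, because one end then always fits.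
  Before that (\<open>poor\<close>), equal end colours are the good state: if a link fails there,
  both of its ends become saturated, and a fresh vertex put between them restores the exact rate. A
  step takes up to four units, so small remainders need separate endgames; there an edge wasted
  earlier may occupy the place of a closing edge, which is why freeness is tracked.\<close>

type_synonym 'a position = "('a \<times> 'a \<times> color) list"

definition vs :: "'a position \<Rightarrow> 'a set" where
  "vs p = (\<Union>(u, v, c) \<in> set p. {u, v})"

definition touched :: "'a position \<Rightarrow> color \<Rightarrow> 'a \<Rightarrow> bool" where
  "touched p c v \<longleftrightarrow> (\<exists>x. (v, x, c) \<in> set p \<or> (x, v, c) \<in> set p)"

text \<open>Every further edge at a saturated vertex is green.\<close>

definition sat :: "'a position \<Rightarrow> 'a \<Rightarrow> bool" where
  "sat p v \<longleftrightarrow> (\<forall>c. c \<noteq> Green \<longrightarrow> touched p c v)"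

definition free :: "'a position \<Rightarrow> 'a \<Rightarrow> 'a \<Rightarrow> bool" where
  "free p u v \<longleftrightarrow> (\<forall>c. (u, v, c) \<notin> set p \<and> (v, u, c) \<notin> set p)"

definition green :: "'a position \<Rightarrow> 'a \<Rightarrow> 'a \<Rightarrow> bool" where
  "green p u v \<longleftrightarrow> (u, v, Green) \<in> set p \<or> (v, u, Green) \<in> set p"

definition gpath :: "'a position \<Rightarrow> 'a list \<Rightarrow> bool" where
  "gpath p xs \<longleftrightarrow> distinct xs \<and> successively (green p) xs \<and> set xs \<subseteq> vs p"

definition gcycle :: "nat \<Rightarrow> 'a position \<Rightarrow> bool" where
  "gcycle N p \<longleftrightarrow> (\<exists>xs. gpath p xs \<and> length xs = N \<and> green p (last xs) (hd xs))"

text \<open>Builder can force a green cycle of length \<open>N\<close> within the given number of moves. Painter's moves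
  that create a red or blue path on three vertices end the game at once and are left out.\<close>

primrec wins :: "nat \<Rightarrow> nat \<Rightarrow> 'a position \<Rightarrow> bool" where
  "wins N 0 p \<longleftrightarrow> gcycle N p"
| "wins N (Suc n) p \<longleftrightarrow> gcycle N p \<or>
     (\<exists>u v. u \<noteq> v \<and> free p u v \<and>
        (\<forall>c. (c \<noteq> Green \<longrightarrow> \<not> touched p c u \<and> \<not> touched p c v) \<longrightarrow> wins N n ((u, v, c) # p)))"

lemma finite_vs [simp]: "finite (vs p)"
  by (auto simp: vs_def)

lemma vs_Nil [simp]: "vs [] = {}"
  by (simp add: vs_def)

lemma vs_Cons [simp]: "vs ((u, v, c) # p) = insert u (insert v (vs p))"
  by (auto simp: vs_def)

lemma touched_Cons [simp]:
  "touched ((u, v, c) # p) d x \<longleftrightarrow> (d = c \<and> (x = u \<or> x = v)) \<or> touched p d x"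
  by (auto simp: touched_def)

lemma touched_in_vs: "touched p c v \<Longrightarrow> v \<in> vs p"
  by (force simp: touched_def vs_def)

lemma sat_Cons [simp]: "sat p x \<Longrightarrow> sat (t # p) x"
  by (cases t) (auto simp: sat_def)

lemma sat_in_vs: "sat p v \<Longrightarrow> v \<in> vs p"
  using touched_in_vs[of p Red v] by (simp add: sat_def)

lemma nongreen_cases: "c \<noteq> Green \<Longrightarrow> d \<noteq> Green \<Longrightarrow> c \<noteq> d \<Longrightarrow> e \<noteq> Green \<Longrightarrow> e = c \<or> e = d"
  by (cases c; cases d; cases e) auto

lemma sat_two_colors:
  "touched p c v \<Longrightarrow> touched p d v \<Longrightarrow> c \<noteq> d \<Longrightarrow> c \<noteq> Green \<Longrightarrow> d \<noteq> Green \<Longrightarrow> sat p v"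
  unfolding sat_def by (metis nongreen_cases)

lemma sat_new:
  assumes "touched p d v" "\<not> touched p c v" "c \<noteq> Green" "d \<noteq> Green" "v = x \<or> v = y"
  shows "sat ((x, y, c) # p) v"
  using assms by (intro sat_two_colors[of _ c _ d]) auto

lemma free_Cons [simp]:
  "free ((u, v, c) # p) x y \<longleftrightarrow> \<not> (x = u \<and> y = v) \<and> \<not> (x = v \<and> y = u) \<and> free p x y"
  by (auto simp: free_def)

lemma free_fresh [simp]: "w \<notin> vs p \<Longrightarrow> free p u w" "w \<notin> vs p \<Longrightarrow> free p w u"
  by (force simp: free_def vs_def)+

lemma green_Cons [simp]:
  "green ((u, v, c) # p) x y \<longleftrightarrow>
     (c = Green \<and> (x = u \<and> y = v \<or> x = v \<and> y = u)) \<or> green p x y"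
  by (auto simp: green_def)

lemma green_sym: "green p x y \<Longrightarrow> green p y x"
  by (auto simp: green_def)

lemma gpath_Nil [simp]: "gpath p []"
  by (simp add: gpath_def)

lemma gpath_Cons [simp]:
  "gpath p (x # xs) \<longleftrightarrow> x \<in> vs p \<and> x \<notin> set xs \<and> gpath p xs \<and> (xs \<noteq> [] \<longrightarrow> green p x (hd xs))"
  by (cases xs) (auto simp: gpath_def)

lemma gpath_append [simp]:
  "gpath p (xs @ ys) \<longleftrightarrow> gpath p xs \<and> gpath p ys \<and> set xs \<inter> set ys = {} \<and>
     (xs \<noteq> [] \<longrightarrow> ys \<noteq> [] \<longrightarrow> green p (last xs) (hd ys))"
  by (auto simp: gpath_def successively_append_iff)

lemma gpath_rev [simp]: "gpath p (rev xs) \<longleftrightarrow> gpath p xs"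
proof -
  have "(\<lambda>x y. green p y x) = green p"
    by (auto simp: fun_eq_iff green_def)
  then show ?thesis
    by (simp only: gpath_def successively_rev distinct_rev set_rev)
qed

lemma gpath_mono_Cons [simp]: "gpath p xs \<Longrightarrow> gpath (t # p) xs"
  by (induction xs; cases t) auto

lemma gpath_subset: "gpath p xs \<Longrightarrow> set xs \<subseteq> vs p"
  by (simp add: gpath_def)

lemma gpath_ends:
  assumes "gpath p P" "2 \<le> length P"
  shows "P \<noteq> []" "hd P \<noteq> last P" "hd P \<in> vs p" "last P \<in> vs p"
proof -
  show "P \<noteq> []"
    using assms by auto
  then show "hd P \<in> vs p" "last P \<in> vs p"
    using gpath_subset[OF assms(1)] by auto
  show "hd P \<noteq> last P"
    using assms by (cases P) (auto split: if_splits)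
qed

lemma fresh_vertex:
  fixes p :: "'a :: infinite position"
  obtains w where "w \<notin> vs p"
  using arb_element[OF finite_vs] by blast

section \<open>Moves with a free and with a forced answer\<close>

lemma wins_cycle:
  assumes "gpath p xs" "length xs = N" "green p (last xs) (hd xs)"
  shows "wins N n p"
proof -
  have "gcycle N p"
    using assms by (auto simp: gcycle_def)
  then show ?thesis
    by (cases n) auto
qed

lemma wins_play:
  assumes "0 < n" "u \<noteq> v" "free p u v" "wins N (n - 1) ((u, v, Green) # p)"
    and "\<And>c. c \<noteq> Green \<Longrightarrow> \<not> touched p c u \<Longrightarrow> \<not> touched p c v \<Longrightarrow> wins N (n - 1) ((u, v, c) # p)"
  shows "wins N n p"
proof (cases n)
  case (Suc m)
  have "wins N m ((u, v, c) # p)" if "c \<noteq> Green \<longrightarrow> \<not> touched p c u \<and> \<not> touched p c v" for c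
    using assms(4,5) that Suc by (cases "c = Green") auto
  then show ?thesis
    using assms Suc by auto
qed (use assms in simp)

lemma wins_force:
  assumes "0 < n" "u \<noteq> v" "free p u v" "wins N (n - 1) ((u, v, Green) # p)"
    and "sat p u \<or> sat p v \<or>
      (\<exists>c d. touched p c u \<and> touched p d v \<and> c \<noteq> d \<and> c \<noteq> Green \<and> d \<noteq> Green)"
  shows "wins N n p"
proof (rule wins_play[OF assms(1-4)])
  fix c assume "c \<noteq> Green" "\<not> touched p c u" "\<not> touched p c v"
  then have False
    using assms(5) by (auto simp: sat_def dest: nongreen_cases[where e = c])
  then show "wins N (n - 1) ((u, v, c) # p)" ..
qed

lemma wins_force_sat:
  assumes "sat p u \<or> sat p v" "0 < n" "u \<noteq> v" "free p u v" "wins N (n - 1) ((u, v, Green) # p)"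
  shows "wins N n p"
  using assms(1) by (intro wins_force[OF assms(2-5)]) auto

lemma wins_force_colors:
  assumes "touched p c u" "touched p d v" "c \<noteq> d" "c \<noteq> Green" "d \<noteq> Green"
    and "0 < n" "u \<noteq> v" "free p u v" "wins N (n - 1) ((u, v, Green) # p)"
  shows "wins N n p"
  using assms(1-5) by (intro wins_force[OF assms(6-9)]) auto

text \<open>\<open>lev p m v\<close>: at most \<open>m\<close> of the colours red and blue are still available at \<open>v\<close>.\<close>

definition lev :: "'a position \<Rightarrow> nat \<Rightarrow> 'a \<Rightarrow> bool" where
  "lev p m v \<longleftrightarrow> (m = 0 \<longrightarrow> sat p v) \<and> (m = 1 \<longrightarrow> (\<exists>c. c \<noteq> Green \<and> touched p c v))"

lemma lev_step:
  assumes "lev p (Suc m) v" "c \<noteq> Green" "\<not> touched p c v" "v = x \<or> v = y"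
  shows "lev ((x, y, c) # p) m v"
  using assms sat_new[of p _ v c x y] by (auto simp: lev_def)

lemma lev_Cons [simp]: "lev p m v \<Longrightarrow> lev (t # p) m v"
  by (cases t) (auto simp: lev_def)

declare wins.simps [simp del]

section \<open>Closing a nearly complete green path\<close>

lemma fresh_for_path:
  fixes p :: "'a :: infinite position"
  assumes "gpath p P" "2 \<le> length P"
  obtains w where "w \<notin> vs p" "w \<notin> set P" "w \<noteq> hd P" "w \<noteq> last P" "hd P \<noteq> w" "last P \<noteq> w"
proof -
  obtain w where "w \<notin> vs p" by (rule fresh_vertex)
  with that show thesis
    using gpath_ends[OF assms] gpath_subset[OF assms(1)] by blast
qed

text \<open>Builder keeps joining \<open>hd P\<close> to fresh vertices. A green answer is completed
  by a forced edge to the saturated \<open>last P\<close>; any other answer uses up a colour at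
  \<open>hd P\<close>, which can happen only \<open>m\<close> times before \<open>hd P\<close> is
  saturated as well.\<close>

lemma close_two_sat:
  fixes p :: "'a :: infinite position"
  assumes "gpath p P" "N = length P + 1" "2 \<le> length P" "sat p (last P)" "lev p m (hd P)" "2 + m \<le> n"
  shows "wins N n p"
  using assms
proof (induction m arbitrary: p n)
  case 0
  obtain t where t: "t \<notin> vs p" "t \<notin> set P" "t \<noteq> hd P" "t \<noteq> last P" "hd P \<noteq> t" "last P \<noteq> t"
    using 0(1,3) by (rule fresh_for_path)
  have s: "sat p (hd P)" using 0 by (simp add: lev_def)
  note F = 0 gpath_ends[OF 0(1,3)] t s
  show ?case
    apply (rule wins_force_sat[of _ "hd P" t]; (use F in simp)?)
    apply (rule wins_force_sat[of _ "t" "last P"]; (use F in simp)?)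
    apply (rule wins_cycle[of _ "P @ [t]"]; (use F in simp)?)
    done
next
  case (Suc m)
  obtain t where t: "t \<notin> vs p" "t \<notin> set P" "t \<noteq> hd P" "t \<noteq> last P" "hd P \<noteq> t" "last P \<noteq> t"
    using Suc.prems(1,3) by (rule fresh_for_path)
  note F = Suc.prems gpath_ends[OF Suc.prems(1,3)] t
  show ?case
  proof (rule wins_play[of _ "hd P" t])
    show "wins N (n - 1) ((hd P, t, Green) # p)"
      apply (rule wins_force_sat[of _ "t" "last P"]; (use F in simp)?)
      apply (rule wins_cycle[of _ "P @ [t]"]; (use F in simp)?)
      done
  next
    fix c assume c: "c \<noteq> Green" "\<not> touched p c (hd P)"
    show "wins N (n - 1) ((hd P, t, c) # p)"
      using Suc.prems c by (intro Suc.IH) (auto intro: lev_step)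
  qed (use F in auto)
qed

lemma lev_0 [simp]: "lev p 0 v \<longleftrightarrow> sat p v"
  by (simp add: lev_def)

lemma lev_1 [simp]: "lev p (Suc 0) v \<longleftrightarrow> (\<exists>c. c \<noteq> Green \<and> touched p c v)"
  by (simp add: lev_def)

lemma lev_2 [simp]: "lev p 2 v"
  by (simp add: lev_def)

text \<open>The pendant vertex \<open>z\<close> is a second candidate for the missing vertex. As
  \<open>hd P\<close> has one colour already, a failed attempt there saturates it, and the other
  candidate is then joined by a forced edge.\<close>

lemma close_two_pendant:
  fixes p :: "'a :: infinite position"
  assumes "gpath p P" "N = length P + 1" "2 \<le> length P" "c \<noteq> Green" "touched p c (hd P)"
    and "lev p m (last P)" "green p (last P) z" "z \<notin> set P" "z \<in> vs p" "free p (hd P) z" "2 + m \<le> n"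
  shows "wins N n p"
  using assms
proof (induction m arbitrary: p n)
  case 0
  obtain t where t: "t \<notin> vs p" "t \<notin> set P" "t \<noteq> hd P" "t \<noteq> last P" "hd P \<noteq> t" "last P \<noteq> t"
    using 0(1,3) by (rule fresh_for_path)
  have z: "z \<noteq> hd P" "z \<noteq> last P" "hd P \<noteq> z" "last P \<noteq> z" "t \<noteq> z" "z \<noteq> t"
    using 0 gpath_ends[OF 0(1,3)] t by auto
  note F = 0 gpath_ends[OF 0(1,3)] t z
  show ?case
  proof (rule wins_play[of _ "hd P" t])
    show "wins N (n - 1) ((hd P, t, Green) # p)"
      apply (rule wins_force_sat[of _ "t" "last P"]; (use F in simp)?)
      apply (rule wins_cycle[of _ "P @ [t]"]; (use F in simp)?)
      done
  next
    fix d assume d: "d \<noteq> Green" "\<not> touched p d (hd P)"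
    then have s: "sat ((hd P, t, d) # p) (hd P)"
      using 0 by (intro sat_new[of _ c]) auto
    show "wins N (n - 1) ((hd P, t, d) # p)"
      apply (rule wins_force_sat[of _ "hd P" "z"]; (use F s in simp)?)
      apply (rule wins_cycle[of _ "P @ [z]"]; (use F in \<open>simp add: green_sym\<close>)?)
      done
  qed (use F in auto)
next
  case (Suc m)
  obtain t where t: "t \<notin> vs p" "t \<notin> set P" "t \<noteq> hd P" "t \<noteq> last P" "hd P \<noteq> t" "last P \<noteq> t"
    using Suc.prems(1,3) by (rule fresh_for_path)
  have z: "z \<noteq> hd P" "z \<noteq> last P" "hd P \<noteq> z" "last P \<noteq> z" "t \<noteq> z" "z \<noteq> t"
    using Suc.prems gpath_ends[OF Suc.prems(1,3)] t by auto
  note F = Suc.prems gpath_ends[OF Suc.prems(1,3)] t z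
  show ?case
  proof (rule wins_play[of _ "last P" t])
    show "wins N (n - 1) ((last P, t, Green) # p)" (is "wins N _ ?p")
    proof (rule wins_play[of _ "hd P" z])
      show "wins N (n - 1 - 1) ((hd P, z, Green) # ?p)"
        by (rule wins_cycle[of _ "P @ [z]"]; (use F in \<open>simp add: green_sym\<close>)?)
    next
      fix d assume d: "d \<noteq> Green" "\<not> touched ?p d (hd P)"
      then have s: "sat ((hd P, z, d) # ?p) (hd P)"
        using Suc.prems by (intro sat_new[of _ c]) auto
      show "wins N (n - 1 - 1) ((hd P, z, d) # ?p)"
        apply (rule wins_force_sat[of _ "hd P" "t"]; (use F s in simp)?)
        apply (rule wins_cycle[of _ "P @ [t]"]; (use F in simp)?)
        done
    qed (use F in auto)
  next
    fix d assume d: "d \<noteq> Green" "\<not> touched p d (last P)"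
    show "wins N (n - 1) ((last P, t, d) # p)"
      using F d by (intro Suc.IH) (auto intro: lev_step)
  qed (use F in auto)
qed

text \<open>A green answer at \<open>last P\<close> is never lost: the path is not extended, but the
  new neighbour serves as the pendant vertex of \<open>close_two_pendant\<close>, which needs one
  move less.\<close>

lemma close_two:
  fixes p :: "'a :: infinite position"
  assumes "gpath p P" "N = length P + 1" "2 \<le> length P" "c \<noteq> Green" "touched p c (hd P)"
    and "lev p m (last P)" "3 + m \<le> n"
  shows "wins N n p"
  using assms
proof (induction m arbitrary: p n)
  case 0
  then show ?case
    by (intro close_two_sat[of p P N 1]) auto
next
  case (Suc m)
  obtain t where t: "t \<notin> vs p" "t \<notin> set P" "t \<noteq> hd P" "t \<noteq> last P" "hd P \<noteq> t" "last P \<noteq> t"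
    using Suc.prems(1,3) by (rule fresh_for_path)
  note F = Suc.prems gpath_ends[OF Suc.prems(1,3)] t
  show ?case
  proof (rule wins_play[of _ "last P" t])
    show "wins N (n - 1) ((last P, t, Green) # p)"
      by (rule close_two_pendant[of _ P _ c "Suc m" t]; (use F in simp)?)
  next
    fix d assume d: "d \<noteq> Green" "\<not> touched p d (last P)"
    show "wins N (n - 1) ((last P, t, d) # p)"
      using F d by (intro Suc.IH) (auto intro: lev_step)
  qed (use F in auto)
qed

lemmas close_two_sat_clean = close_two_sat[where m = 2, simplified]
lemmas close_two_clean = close_two[where m = 2, simplified]

lemma close_two_sat_unit:
  fixes p :: "'a :: infinite position"
  assumes "gpath p P" "N = length P + 1" "2 \<le> length P" "sat p (last P)"
    and "c \<noteq> Green" "touched p c (hd P)" "3 \<le> n"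
  shows "wins N n p"
  using assms by (intro close_two_sat[of p P N 1]) auto

lemma close_two_unit:
  fixes p :: "'a :: infinite position"
  assumes "gpath p P" "N = length P + 1" "2 \<le> length P" "c \<noteq> Green" "touched p c (hd P)"
    and "d \<noteq> Green" "touched p d (last P)" "4 \<le> n"
  shows "wins N n p"
  using assms by (intro close_two[of p P N c 1]) auto

lemma close_two_pendant_unit:
  fixes p :: "'a :: infinite position"
  assumes "gpath p P" "N = length P + 1" "2 \<le> length P" "c \<noteq> Green" "touched p c (hd P)"
    and "d \<noteq> Green" "touched p d (last P)" "green p (last P) z" "z \<notin> set P" "z \<in> vs p" "free p (hd P) z" "3 \<le> n"
  shows "wins N n p"
  using assms by (intro close_two_pendant[of p P N c 1 z]) auto

section \<open>Two vertices missing\<close>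

lemma close_three_sat:
  fixes p :: "'a :: infinite position"
  assumes "gpath p P" "N = length P + 2" "2 \<le> length P" "c \<noteq> Green" "touched p c (hd P)"
    and "sat p (last P)" "5 \<le> n"
  shows "wins N n p"
proof -
  obtain t where t: "t \<notin> vs p" "t \<notin> set P" "t \<noteq> hd P" "t \<noteq> last P" "hd P \<noteq> t" "last P \<noteq> t"
    using assms(1,3) by (rule fresh_for_path)
  note F = assms gpath_ends[OF assms(1,3)] t
  show ?thesis
  proof (rule wins_play[of _ "hd P" t])
    show "wins N (n - 1) ((hd P, t, Green) # p)"
      by (rule close_two_sat_clean[of _ "t # P"]; (use F in simp)?)
  next
    fix d assume d: "d \<noteq> Green" "\<not> touched p d (hd P)"
    let ?p = "(hd P, t, d) # p"
    have s: "sat ?p (hd P)"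
      using d assms by (intro sat_new[of _ c]) auto
    have g: "gpath ?p P" using assms by simp
    obtain u where u: "u \<notin> vs ?p" "u \<notin> set P" "u \<noteq> hd P" "u \<noteq> last P" "hd P \<noteq> u" "last P \<noteq> u"
      using g assms(3) by (rule fresh_for_path)
    note F = F d s u not_sym[of u t]
    show "wins N (n - 1) ?p"
    \<comment> \<open>The vertex \<open>t\<close> of the wasted edge is used again. Both ends of
      \<open>P\<close> are now saturated, so a green \<open>u t\<close> closes at once, and a wasted
      one saturates \<open>t\<close>, which can then be joined to anything.\<close>
    proof (rule wins_play[of _ u t])
      show "wins N (n - 1 - 1) ((u, t, Green) # ?p)"
        apply (rule wins_force_sat[of _ "hd P" u]; (use F in simp)?)
        apply (rule wins_force_sat[of _ t "last P"]; (use F in simp)?)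
        apply (rule wins_cycle[of _ "P @ [t, u]"]; (use F in simp)?)
        done
    next
      fix e assume e: "e \<noteq> Green" "\<not> touched ?p e t"
      let ?q = "(u, t, e) # ?p"
      have s': "sat ?q t"
        using e d by (intro sat_new[of _ d]) auto
      have g: "gpath ?q P" using assms by simp
      obtain v where v: "v \<notin> vs ?q" "v \<notin> set P" "v \<noteq> hd P" "v \<noteq> last P" "hd P \<noteq> v" "last P \<noteq> v"
        using g assms(3) by (rule fresh_for_path)
      note F = F e s' v not_sym[of v t] not_sym[of v u]
      show "wins N (n - 1 - 1) ?q"
        apply (rule wins_force_sat[of _ "hd P" v]; (use F in simp)?)
        apply (rule wins_force_sat[of _ v t]; (use F in simp)?)
        apply (rule wins_force_sat[of _ t "last P"]; (use F in simp)?)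
        apply (rule wins_cycle[of _ "P @ [t, v]"]; (use F in simp)?)
        done
    qed (use F in auto)
  qed (use F in auto)
qed

lemma close_three:
  fixes p :: "'a :: infinite position"
  assumes "gpath p P" "N = length P + 2" "2 \<le> length P"
    and "c \<noteq> Green" "touched p c (hd P)" "d \<noteq> Green" "touched p d (last P)" "6 \<le> n"
  shows "wins N n p"
proof -
  obtain w where w: "w \<notin> vs p" "w \<notin> set P" "w \<noteq> hd P" "w \<noteq> last P" "hd P \<noteq> w" "last P \<noteq> w"
    using assms(1,3) by (rule fresh_for_path)
  note F = assms gpath_ends[OF assms(1,3)] w
  show ?thesis
  proof (rule wins_play[of _ "last P" w])
    show "wins N (n - 1) ((last P, w, Green) # p)"
      by (rule close_two_clean[of _ "P @ [w]" _ c]; (use F in simp)?)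
  next
    fix e assume e: "e \<noteq> Green" "\<not> touched p e (last P)"
    let ?p = "(last P, w, e) # p"
    have s: "sat ?p (last P)"
      using e assms by (intro sat_new[of _ d]) auto
    note F = F e s
    show "wins N (n - 1) ?p"
    \<comment> \<open>If the colours differ, the wasted vertex \<open>w\<close> is put at the head
      of the path by force. If they agree, a second wasted edge at \<open>hd P\<close> has the other
      colour, so that \<open>w\<close> and its far end \<open>u\<close> can be joined by
      force.\<close>
    proof (cases "c = e")
      case False
      show ?thesis
        apply (rule wins_force_colors[of _ c "hd P" e w]; (use F False in simp)?)
         apply (rule close_two_sat_unit[of _ "w # P" _ e]; (use F in simp)?)
        done
    next
      case True
      have g: "gpath ?p P" using assms by simp
      obtain u where u: "u \<notin> vs ?p" "u \<notin> set P" "u \<noteq> hd P" "u \<noteq> last P" "hd P \<noteq> u" "last P \<noteq> u"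
        using g assms(3) by (rule fresh_for_path)
      note F = F u True not_sym[of u w]
      show ?thesis
      proof (rule wins_play[of _ "hd P" u])
        show "wins N (n - 1 - 1) ((hd P, u, Green) # ?p)"
          by (rule close_two_sat_clean[of _ "u # P"]; (use F in simp)?)
      next
        fix f assume f: "f \<noteq> Green" "\<not> touched ?p f (hd P)"
        have s': "sat ((hd P, u, f) # ?p) (hd P)"
          using f assms by (intro sat_new[of _ c]) auto
        have ef: "e \<noteq> f"
          using f assms True by auto
        note F = F f s' ef
        show "wins N (n - 1 - 1) ((hd P, u, f) # ?p)"
          apply (rule wins_force_sat[of _ "hd P" w]; (use F in simp)?)
          apply (rule wins_force_sat[of _ u "last P"]; (use F in simp)?)
          apply (rule wins_force_colors[of _ e w f u]; (use F in simp)?)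
           apply (rule wins_cycle[of _ "P @ [u, w]"]; (use F in simp)?)
          done
      qed (use F in auto)
    qed
  qed (use F in auto)
qed

section \<open>Three vertices missing\<close>

lemma close_four_same:
  fixes p :: "'a :: infinite position"
  assumes "gpath p P" "N = length P + 3" "2 \<le> length P"
    and "c \<noteq> Green" "touched p c (hd P)" "touched p c (last P)" "7 \<le> n"
  shows "wins N n p"
proof -
  obtain w where w: "w \<notin> vs p" "w \<notin> set P" "w \<noteq> hd P" "w \<noteq> last P" "hd P \<noteq> w" "last P \<noteq> w"
    using assms(1,3) by (rule fresh_for_path)
  note F = assms gpath_ends[OF assms(1,3)] w
  show ?thesis
  proof (rule wins_play[of _ "last P" w])
    fix e assume e: "e \<noteq> Green" "\<not> touched p e (last P)"
    let ?p = "(last P, w, e) # p"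
    have s: "sat ?p (last P)"
      using e assms by (intro sat_new[of _ c]) auto
    have ce: "c \<noteq> e" using e assms by auto
    note F = F e s ce
    show "wins N (n - 1) ?p"
      apply (rule wins_force_colors[of _ c "hd P" e w]; (use F in simp)?)
       apply (rule close_three_sat[of _ "w # P" _ e]; (use F in simp)?)
      done
  next
    let ?p = "(last P, w, Green) # p"
    obtain z where z: "z \<notin> vs ?p" by (rule fresh_vertex)
    then have z': "z \<notin> set P" "z \<noteq> hd P" "z \<noteq> last P" "hd P \<noteq> z" "last P \<noteq> z" "z \<noteq> w" "w \<noteq> z"
      using F gpath_subset[OF assms(1)] by auto
    note F = F z z'
    show "wins N (n - 1) ?p"
    proof (rule wins_play[of _ w z])
      show "wins N (n - 1 - 1) ((w, z, Green) # ?p)"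
        by (rule close_two_clean[of _ "P @ [w, z]" _ c]; (use F in simp)?)
    next
      fix g assume g: "g \<noteq> Green"
      let ?q = "(w, z, g) # ?p"
      \<comment> \<open>If \<open>g\<close> differs from \<open>c\<close>, then \<open>z\<close> is
        forced onto the head of \<open>P\<close>. Otherwise \<open>w\<close>, \<open>z\<close> and
        both ends of \<open>P\<close> all carry \<open>c\<close>, so any further wasted edge between
        two of them saturates both of its ends.\<close>
      show "wins N (n - 1 - 1) ?q"
      proof (cases "g = c")
        case False
        show ?thesis
          apply (rule wins_force_colors[of _ c "hd P" g z]; (use F g False in simp)?)
           apply (rule close_two_unit[of _ "z # P @ [w]" _ g g]; (use F g in simp)?)
          done
      next
        case True
        obtain y where y: "y \<notin> vs ?q" by (rule fresh_vertex)
        then have y': "y \<notin> set P" "y \<noteq> hd P" "y \<noteq> last P" "hd P \<noteq> y" "last P \<noteq> y" "y \<noteq> w" "w \<noteq> y"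
            "y \<noteq> z" "z \<noteq> y"
          using F gpath_subset[OF assms(1)] by auto
        note F = F g True y y'
        show ?thesis
        proof (rule wins_play[of _ w y])
          fix e assume e: "e \<noteq> Green" "\<not> touched ?q e w"
          have s: "sat ((w, y, e) # ?q) w"
            using e g by (intro sat_new[of _ g]) auto
          have ce: "c \<noteq> e" using e True by auto
          note F = F e s ce
          show "wins N (n - 1 - 1 - 1) ((w, y, e) # ?q)"
            apply (rule wins_force_colors[of _ c "hd P" e y]; (use F in simp)?)
             apply (rule close_two_sat_unit[of _ "y # P @ [w]" _ e]; (use F in simp)?)
            done
        next
          let ?r = "(w, y, Green) # ?q"
          show "wins N (n - 1 - 1 - 1) ?r"
          \<comment> \<open>Here \<open>y\<close> is a green neighbour of \<open>w\<close>. A green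
            answer makes it a pendant vertex of the path with one vertex missing; a wasted one
            saturates \<open>hd P\<close> and \<open>z\<close>, and the cycle then runs through
            \<open>z\<close>, \<open>y\<close>, \<open>w\<close>.\<close>
          proof (rule wins_play[of _ "hd P" z])
            show "wins N (n - 1 - 1 - 1 - 1) ((hd P, z, Green) # ?r)"
              apply (rule close_two_pendant_unit[of _ "z # P @ [w]" _ c c y]; (use F in simp)?)
              done
          next
            fix e assume e: "e \<noteq> Green" "\<not> touched ?r e (hd P)" "\<not> touched ?r e z"
            have s: "sat ((hd P, z, e) # ?r) (hd P)" "sat ((hd P, z, e) # ?r) z"
              using e g assms by (intro sat_new[of _ c]; simp add: True)+
            note F = F e s
            show "wins N (n - 1 - 1 - 1 - 1) ((hd P, z, e) # ?r)"
              apply (rule wins_force_sat[of _ "last P" z]; (use F in simp)?)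
              apply (rule wins_force_sat[of _ z y]; (use F in simp)?)
              apply (rule wins_force_sat[of _ "hd P" w]; (use F in simp)?)
              apply (rule wins_cycle[of _ "P @ [z, y, w]"]; (use F in simp)?)
              done
          qed (use F in auto)
        qed (use F in auto)
      qed
    qed (use F in auto)
  qed (use F in auto)
qed

lemma close_four_distinct:
  fixes p :: "'a :: infinite position"
  assumes "gpath p P" "N = length P + 3" "2 \<le> length P" "c \<noteq> d"
    and "c \<noteq> Green" "touched p c (hd P)" "d \<noteq> Green" "touched p d (last P)" "8 \<le> n"
  shows "wins N n p"
proof -
  obtain w where w: "w \<notin> vs p" "w \<notin> set P" "w \<noteq> hd P" "w \<noteq> last P" "hd P \<noteq> w" "last P \<noteq> w"
    using assms(1,3) by (rule fresh_for_path)
  note F = assms gpath_ends[OF assms(1,3)] w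
  show ?thesis
  proof (rule wins_play[of _ "last P" w])
    let ?p = "(last P, w, Green) # p"
    obtain z where z: "z \<notin> vs ?p" by (rule fresh_vertex)
    then have z': "z \<notin> set P" "z \<noteq> hd P" "z \<noteq> last P" "hd P \<noteq> z" "last P \<noteq> z" "z \<noteq> w" "w \<noteq> z"
      using F gpath_subset[OF assms(1)] by auto
    note F = F z z'
    show "wins N (n - 1) ?p"
    proof (rule wins_play[of _ w z])
      show "wins N (n - 1 - 1) ((w, z, Green) # ?p)"
        by (rule close_two_clean[of _ "P @ [w, z]" _ c]; (use F in simp)?)
    next
      fix g assume "g \<noteq> Green"
      then show "wins N (n - 1 - 1) ((w, z, g) # ?p)"
        by (intro close_three[of _ "P @ [w]" _ c g]; (use F in simp)?)
    qed (use F in auto)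
  next
    fix e assume e: "e \<noteq> Green" "\<not> touched p e (last P)"
    let ?p = "(last P, w, e) # p"
    have s: "sat ?p (last P)"
      using e assms by (intro sat_new[of _ d]) auto
    \<comment> \<open>Since \<open>d\<close> is present at \<open>last P\<close>, the wasted edge
      has the colour of \<open>hd P\<close>. Hence \<open>w\<close> cannot be forced to
      \<open>hd P\<close> yet; it can once \<open>hd P\<close> is saturated.\<close>
    have ce: "c = e" using e assms nongreen_cases by metis
    have g: "gpath ?p P" using assms by simp
    obtain u where u: "u \<notin> vs ?p" "u \<notin> set P" "u \<noteq> hd P" "u \<noteq> last P" "hd P \<noteq> u" "last P \<noteq> u"
      using g assms(3) by (rule fresh_for_path)
    note F = F e s ce u not_sym[of u w]
    show "wins N (n - 1) ?p"
    proof (rule wins_play[of _ "hd P" u])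
      fix f assume f: "f \<noteq> Green" "\<not> touched ?p f (hd P)"
      have s': "sat ((hd P, u, f) # ?p) (hd P)"
        using f assms by (intro sat_new[of _ c]) auto
      have ef: "e \<noteq> f" using f ce assms by auto
      note F = F f s' ef
      show "wins N (n - 1 - 1) ((hd P, u, f) # ?p)"
        apply (rule wins_force_sat[of _ "hd P" w]; (use F in simp)?)
        apply (rule wins_force_colors[of _ e w f u]; (use F in simp)?)
         apply (rule close_two_sat_unit[of _ "u # w # P" _ f]; (use F in simp)?)
        done
    next
      let ?q = "(hd P, u, Green) # ?p"
      obtain t where t: "t \<notin> vs ?q" by (rule fresh_vertex)
      then have t': "t \<notin> set P" "t \<noteq> hd P" "t \<noteq> last P" "hd P \<noteq> t" "last P \<noteq> t" "t \<noteq> u" "u \<noteq> t"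
        using F gpath_subset[OF assms(1)] by auto
      note F = F t t'
      show "wins N (n - 1 - 1) ?q"
      proof (rule wins_play[of _ u t])
        show "wins N (n - 1 - 1 - 1) ((u, t, Green) # ?q)"
          by (rule close_two_sat_clean[of _ "t # u # P"]; (use F in simp)?)
      next
        fix g assume "g \<noteq> Green"
        then show "wins N (n - 1 - 1 - 1) ((u, t, g) # ?q)"
          by (intro close_three_sat[of _ "u # P" _ g]; (use F in simp)?)
      qed (use F in auto)
    qed (use F in auto)
  qed (use F in auto)
qed

section \<open>Playing on three fresh vertices\<close>

text \<open>A frame condition: new edges lie inside \<open>X\<close>. With \<open>X\<close> the
  three fresh vertices of a piece, all facts about the older paths survive, and every edge between
  an old vertex and \<open>X\<close> is still undrawn.\<close>

definition ext :: "'a position \<Rightarrow> 'a position \<Rightarrow> 'a set \<Rightarrow> bool" where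
  "ext p q X \<longleftrightarrow> set p \<subseteq> set q \<and> (\<forall>u v c. (u, v, c) \<in> set q \<longrightarrow> (u, v, c) \<in> set p \<or> u \<in> X \<and> v \<in> X)"

lemma ext_touched: "ext p q X \<Longrightarrow> touched p c v \<Longrightarrow> touched q c v"
  by (auto simp: ext_def touched_def)

lemma ext_sat: "ext p q X \<Longrightarrow> sat p v \<Longrightarrow> sat q v"
  by (auto simp: sat_def intro: ext_touched)

lemma ext_free: "ext p q X \<Longrightarrow> u \<notin> X \<or> v \<notin> X \<Longrightarrow> free p u v \<Longrightarrow> free q u v"
  unfolding ext_def free_def by blast

lemma ext_gpath:
  assumes "ext p q X" "gpath p xs"
  shows "gpath q xs"
proof -
  have "vs p \<subseteq> vs q"
    using assms(1) by (auto simp: ext_def vs_def)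
  moreover have "green q u v" if "green p u v" for u v
    using that assms(1) by (auto simp: ext_def green_def)
  ultimately show ?thesis
    using assms(2) by (auto simp: gpath_def intro: successively_mono)
qed

text \<open>Builder draws the edges of a triangle and stops early if the first two are green, hence
  \<open>n - 2\<close> in the third case. The colour \<open>d\<close> stands for the end of the path
  to which the piece will be linked: in the first case the green edge is oriented such that
  \<open>x\<close> can be forced to that end while \<open>y\<close> shows \<open>d\<close> again, so
  the end colour is preserved.\<close>

lemma triangle:
  fixes p :: "'a :: infinite position"
  assumes n: "3 \<le> n" and d: "d \<noteq> Green"
    and T1: "\<And>q x y s c. ext p q {x, y, s} \<Longrightarrow> {x, y, s} \<inter> vs p = {} \<Longrightarrow> gpath q [x, y] \<Longrightarrow> s \<notin> {x, y}
      \<Longrightarrow> sat q s \<Longrightarrow> touched q c x \<Longrightarrow> touched q d y \<Longrightarrow> c \<noteq> Green \<Longrightarrow> c \<noteq> d \<Longrightarrow> wins N (n - 3) q"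
    and T2: "\<And>q x m y e. ext p q {x, m, y} \<Longrightarrow> {x, m, y} \<inter> vs p = {} \<Longrightarrow> gpath q [x, m, y]
      \<Longrightarrow> touched q e x \<Longrightarrow> touched q e y \<Longrightarrow> e \<noteq> Green \<Longrightarrow> wins N (n - 3) q"
    and T3: "\<And>q x m y. ext p q {x, m, y} \<Longrightarrow> {x, m, y} \<inter> vs p = {} \<Longrightarrow> gpath q [x, m, y]
      \<Longrightarrow> wins N (n - 2) q"
  shows "wins N n p"
proof -
  have T1': "wins N (n - 1 - 1 - 1) q"
    if "ext p q {x, y, s}" "{x, y, s} \<inter> vs p = {}" "gpath q [x, y]" "s \<notin> {x, y}"
      "sat q s" "touched q c x" "touched q c' y" "c \<noteq> Green" "c' \<noteq> Green" "c \<noteq> c'"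
    for q x y s c c'
  proof -
    have yx: "gpath q [y, x]" "ext p q {y, x, s}" "{y, x, s} \<inter> vs p = {}" "s \<notin> {y, x}"
      using that(1-4) by (auto simp: green_def insert_commute)
    have "wins N (n - 3) q"
    proof (cases "c' = d")
      case True
      then show ?thesis
        using that by (intro T1[of q x y s c]) auto
    next
      case False
      then have "c = d"
        using nongreen_cases[of c c' d] that d by auto
      then show ?thesis
        using yx that by (intro T1[of q y x s c']) auto
    qed
    then show ?thesis
      by (simp add: numeral_3_eq_3)
  qed
  have T2': "wins N (n - 1 - 1 - 1) q"
    if "ext p q {x, m, y}" "{x, m, y} \<inter> vs p = {}" "gpath q [x, m, y]"
      "touched q e x" "touched q e y" "e \<noteq> Green" for q x m y e
    using T2[OF that] by (simp add: numeral_3_eq_3)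
  obtain u where u: "u \<notin> vs p" by (rule fresh_vertex)
  \<comment> \<open>The triple with equal ends is never played; it only makes \<open>v\<close>
    differ from \<open>u\<close>.\<close>
  obtain v where v: "v \<notin> vs ((u, u, Green) # p)" by (rule fresh_vertex)
  obtain w where w: "w \<notin> vs ((u, v, Green) # p)" by (rule fresh_vertex)
  have F: "u \<notin> vs p" "v \<notin> vs p" "w \<notin> vs p" "u \<noteq> v" "u \<noteq> w" "v \<noteq> w" "v \<noteq> u" "w \<noteq> u" "w \<noteq> v"
      "\<And>c. \<not> touched p c u" "\<And>c. \<not> touched p c v" "\<And>c. \<not> touched p c w"
    using u v w touched_in_vs[of p] by auto
  show ?thesis
  proof (rule wins_play[of _ u v])
    let ?p = "(u, v, Green) # p"
    show "wins N (n - 1) ?p"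
    proof (rule wins_play[of _ v w])
      have "n - 1 - 1 = n - 2" by simp
      then show "wins N (n - 1 - 1) ((v, w, Green) # ?p)"
        using F by (auto intro!: T3[of _ u v w] simp: ext_def)
    next
      fix c assume c: "c \<noteq> Green"
      let ?q = "(v, w, c) # ?p"
      show "wins N (n - 1 - 1) ?q"
      proof (rule wins_play[of _ w u])
        show "wins N (n - 1 - 1 - 1) ((w, u, Green) # ?q)"
          using F c by (intro T2'[of _ v u w c]) (auto simp: ext_def)
      next
        fix e assume e: "e \<noteq> Green" "\<not> touched ?q e w"
        then show "wins N (n - 1 - 1 - 1) ((w, u, e) # ?q)"
          using F c by (intro T1'[of _ v u w c e]) (auto simp: ext_def intro: sat_new)
      qed (use F n in auto)
    qed (use F n in auto)
  next
    fix c assume c: "c \<noteq> Green"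
    let ?p = "(u, v, c) # p"
    show "wins N (n - 1) ?p"
    proof (rule wins_play[of _ v w])
      let ?q = "(v, w, Green) # ?p"
      show "wins N (n - 1 - 1) ?q"
      proof (rule wins_play[of _ w u])
        show "wins N (n - 1 - 1 - 1) ((w, u, Green) # ?q)"
          using F c by (intro T2'[of _ v w u c]) (auto simp: ext_def)
      next
        fix e assume e: "e \<noteq> Green" "\<not> touched ?q e u"
        then show "wins N (n - 1 - 1 - 1) ((w, u, e) # ?q)"
          using F c by (intro T1'[of _ v w u c e]) (auto simp: ext_def intro: sat_new)
      qed (use F n in auto)
    next
      fix e assume e: "e \<noteq> Green" "\<not> touched ?p e v"
      let ?q = "(v, w, e) # ?p"
      have s: "sat ?q v"
        using c e by (intro sat_new[of _ c]) auto
      have ce: "c \<noteq> e" using e by auto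
      show "wins N (n - 1 - 1) ?q"
      proof (rule wins_force_colors[of _ c u e w])
        show "wins N (n - 1 - 1 - 1) ((u, w, Green) # ?q)"
          using F c e s ce by (intro T1'[of _ u w v c e]) (auto simp: ext_def)
      qed (use F n c e ce in auto)
    qed (use F n in auto)
  qed (use F n in auto)
qed

section \<open>Two green paths\<close>

text \<open>\<open>S\<close> may be a single saturated vertex, whose two ends then coincide;
  \<open>P\<close> has two vertices at least, so that colours at its ends belong to different
  vertices.\<close>

definition two_paths :: "'a position \<Rightarrow> 'a list \<Rightarrow> 'a list \<Rightarrow> bool" where
  "two_paths p P S \<longleftrightarrow> gpath p P \<and> gpath p S \<and> 2 \<le> length P \<and> S \<noteq> [] \<and> set P \<inter> set S = {} \<and>
     sat p (hd S) \<and> sat p (last S)"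

lemma two_paths_ends:
  assumes "two_paths p P S"
  shows "P \<noteq> []" "hd P \<noteq> last P" "last P \<noteq> hd P" "hd P \<in> vs p" "last P \<in> vs p" "S \<noteq> []" "hd S \<in> vs p" "last S \<in> vs p"
    "hd P \<noteq> hd S" "hd P \<noteq> last S" "last P \<noteq> hd S" "last P \<noteq> last S"
    "hd S \<noteq> hd P" "last S \<noteq> hd P" "hd S \<noteq> last P" "last S \<noteq> last P"
    "hd S \<notin> set P" "last S \<notin> set P" "hd P \<notin> set S" "last P \<notin> set S"
proof -
  have g: "gpath p P" "2 \<le> length P" "S \<noteq> []" "set P \<inter> set S = {}" "gpath p S"
    using assms by (auto simp: two_paths_def)
  note e = gpath_ends[OF g(1,2)]
  have i: "hd P \<in> set P" "last P \<in> set P" "hd S \<in> set S" "last S \<in> set S"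
    using e g by auto
  show "P \<noteq> []" "hd P \<noteq> last P" "last P \<noteq> hd P" "hd P \<in> vs p" "last P \<in> vs p" "S \<noteq> []"
    using e g by auto
  show "hd S \<in> vs p" "last S \<in> vs p"
    using gpath_subset[OF g(5)] i by auto
  show "hd P \<noteq> hd S" "hd P \<noteq> last S" "last P \<noteq> hd S" "last P \<noteq> last S"
    "hd S \<noteq> hd P" "last S \<noteq> hd P" "hd S \<noteq> last P" "last S \<noteq> last P"
    "hd S \<notin> set P" "last S \<notin> set P" "hd P \<notin> set S" "last P \<notin> set S"
    using i g(4) by (metis disjoint_iff)+
qed

lemma two_paths_rev: "two_paths p P S \<Longrightarrow> two_paths p (rev P) (rev S)"
  by (auto simp: two_paths_def hd_rev last_rev)

section \<open>Joining a green path to a path with saturated ends\<close>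

lemma free_sym: "free p u v \<longleftrightarrow> free p v u"
  by (auto simp: free_def)

lemma close_two_paths:
  assumes "two_paths p P S" "N = length P + length S" "free p (last P) (hd S)" "free p (hd P) (last S)" "2 \<le> n"
  shows "wins N n p"
proof -
  note F = assms two_paths_ends[OF assms(1)] assms(1)[unfolded two_paths_def]
  have "free p (last S) (hd P)"
    using assms(4) by (simp add: free_sym)
  note F = F this
  show ?thesis
    apply (rule wins_force_sat[of _ "last P" "hd S"]; (use F in simp)?)
    apply (rule wins_force_sat[of _ "last S" "hd P"]; (use F in simp)?)
    apply (rule wins_cycle[of _ "P @ S"]; (use F in simp)?)
    done
qed

lemma fresh_two_paths:
  fixes p :: "'a :: infinite position"
  assumes "two_paths p P S"
  obtains w where "w \<notin> vs p" "w \<notin> set P" "w \<notin> set S" "w \<noteq> hd P" "w \<noteq> last P" "hd P \<noteq> w" "last P \<noteq> w"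
    "w \<noteq> hd S" "w \<noteq> last S" "hd S \<noteq> w" "last S \<noteq> w"
proof -
  obtain w where w: "w \<notin> vs p" by (rule fresh_vertex)
  have "set P \<subseteq> vs p" "set S \<subseteq> vs p"
    using assms gpath_subset by (auto simp: two_paths_def)
  with w show thesis
    using two_paths_ends[OF assms] by (intro that[of w]) auto
qed

text \<open>With one colour at \<open>hd P\<close>, extending the path there costs two moves at
  most. The new head is fresh, so only the joint at the other end has to be assumed free.\<close>

lemma close_two_paths_one:
  fixes p :: "'a :: infinite position"
  assumes "two_paths p P S" "N = length P + length S + 1" "c \<noteq> Green" "touched p c (hd P)"
    and "free p (last P) (hd S)" "4 \<le> n"
  shows "wins N n p"
proof -
  obtain t where t: "t \<notin> vs p" "t \<notin> set P" "t \<notin> set S" "t \<noteq> hd P" "t \<noteq> last P" "hd P \<noteq> t" "last P \<noteq> t"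
    "t \<noteq> hd S" "t \<noteq> last S" "hd S \<noteq> t" "last S \<noteq> t"
    using assms(1) by (rule fresh_two_paths)
  note F = assms two_paths_ends[OF assms(1)] assms(1)[unfolded two_paths_def] t
  show ?thesis
  proof (rule wins_play[of _ "hd P" t])
    show "wins N (n - 1) ((hd P, t, Green) # p)"
      by (rule close_two_paths[of _ "t # P" S]; (use F in \<open>simp add: two_paths_def\<close>)?)
  next
    fix d assume d: "d \<noteq> Green" "\<not> touched p d (hd P)"
    let ?p = "(hd P, t, d) # p"
    have s: "sat ?p (hd P)"
      using assms d by (intro sat_new[of _ c]) auto
    have "two_paths ?p P S" using F by (simp add: two_paths_def)
    then obtain u where u: "u \<notin> vs ?p" "u \<notin> set P" "u \<notin> set S" "u \<noteq> hd P" "u \<noteq> last P" "hd P \<noteq> u" "last P \<noteq> u"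
      "u \<noteq> hd S" "u \<noteq> last S" "hd S \<noteq> u" "last S \<noteq> u"
      by (rule fresh_two_paths)
    note F = F d s u
    show "wins N (n - 1) ?p"
      apply (rule wins_force_sat[of _ "hd P" u]; (use F in simp)?)
      apply (rule close_two_paths[of _ "u # P" S]; (use F in \<open>simp add: two_paths_def\<close>)?)
      done
  qed (use F in auto)
qed

lemma close_two_paths_two:
  fixes p :: "'a :: infinite position"
  assumes "two_paths p P S" "N = length P + length S + 2" "c \<noteq> Green" "touched p c (hd P)"
    and "d \<noteq> Green" "touched p d (last P)" "6 \<le> n"
  shows "wins N n p"
proof -
  obtain t where t: "t \<notin> vs p" "t \<notin> set P" "t \<notin> set S" "t \<noteq> hd P" "t \<noteq> last P" "hd P \<noteq> t" "last P \<noteq> t"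
    "t \<noteq> hd S" "t \<noteq> last S" "hd S \<noteq> t" "last S \<noteq> t"
    using assms(1) by (rule fresh_two_paths)
  note F = assms two_paths_ends[OF assms(1)] assms(1)[unfolded two_paths_def] t
  show ?thesis
  proof (rule wins_play[of _ "last P" t])
    show "wins N (n - 1) ((last P, t, Green) # p)"
      \<comment> \<open>The joint between \<open>t\<close> and \<open>hd S\<close> is free because
        \<open>t\<close> is fresh; with two missing vertices no freeness has to be assumed.\<close>
      by (rule close_two_paths_one[of _ "P @ [t]" S _ c]; (use F in \<open>simp add: two_paths_def\<close>)?)
  next
    fix e assume e: "e \<noteq> Green" "\<not> touched p e (last P)"
    let ?p = "(last P, t, e) # p"
    have s: "sat ?p (last P)"
      using assms e by (intro sat_new[of _ d]) auto
    have "two_paths ?p P S" using F by (simp add: two_paths_def)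
    then obtain u where u: "u \<notin> vs ?p" "u \<notin> set P" "u \<notin> set S" "u \<noteq> hd P" "u \<noteq> last P" "hd P \<noteq> u" "last P \<noteq> u"
      "u \<noteq> hd S" "u \<noteq> last S" "hd S \<noteq> u" "last S \<noteq> u"
      by (rule fresh_two_paths)
    note F = F e s u
    show "wins N (n - 1) ?p"
      apply (rule wins_force_sat[of _ "last P" u]; (use F in simp)?)
      apply (rule close_two_paths_one[of _ "P @ [u]" S _ c]; (use F in \<open>simp add: two_paths_def\<close>)?)
      done
  qed (use F in auto)
qed

lemma ext_two_paths: "ext p q X \<Longrightarrow> two_paths p P S \<Longrightarrow> two_paths q P S"
  by (simp add: two_paths_def ext_gpath ext_sat)

lemma ext_free_new:
  assumes "ext p q X" "X \<inter> vs p = {}" "u \<in> vs p" "x \<in> X"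
  shows "free q u x" "free q x u"
proof -
  have "u \<notin> X" "x \<notin> vs p"
    using assms by auto
  then show "free q u x" "free q x u"
    by (auto intro: ext_free[OF assms(1)])
qed

lemma ext_path_facts:
  assumes "ext p q X" "X \<inter> vs p = {}" "x \<in> X" "gpath p P" "P \<noteq> []"
  shows "x \<notin> set P" "x \<noteq> hd P" "x \<noteq> last P" "hd P \<noteq> x" "last P \<noteq> x"
    "free q (hd P) x" "free q (last P) x" "free q x (hd P)" "free q x (last P)"
proof -
  have P: "set P \<subseteq> vs p" "hd P \<in> set P" "last P \<in> set P"
    using assms gpath_subset by auto
  then have i: "hd P \<in> vs p" "last P \<in> vs p" by auto
  have "x \<notin> vs p" using assms(2,3) by blast
  then show "x \<notin> set P" "x \<noteq> hd P" "x \<noteq> last P" "hd P \<noteq> x" "last P \<noteq> x"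
    using P(1) i by auto
  show "free q (hd P) x" "free q (last P) x" "free q x (hd P)" "free q x (last P)"
    using ext_free_new[OF assms(1,2) i(1) assms(3)] ext_free_new[OF assms(1,2) i(2) assms(3)] by auto
qed

text \<open>Let \<open>w\<close> be the number of edges wasted so far in a game of \<open>3N/2 + 1\<close> rounds, and let \<open>V\<close> be the
  number of vertices of \<open>P\<close> and \<open>S\<close>. With \<open>r = N - V\<close>, the bound on the number \<open>n\<close> of remaining moves says
  \<open>2w \<le> V + 1\<close> if the ends of \<open>P\<close> have different colours, and \<open>2w \<le> V\<close> if they have the same colour
  (then the next piece may fail to link by a forced edge). The freeness condition matters since the
  saturated vertex of a piece is joined by wasted edges to the ends of the green edge of that piece.\<close>

definition rich :: "nat \<Rightarrow> nat \<Rightarrow> 'a position \<Rightarrow> bool" where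
  "rich N r p \<longleftrightarrow> (\<forall>P S c d n. two_paths p P S \<longrightarrow> N = length P + length S + r \<longrightarrow>
     c \<noteq> Green \<longrightarrow> touched p c (hd P) \<longrightarrow> d \<noteq> Green \<longrightarrow> touched p d (last P) \<longrightarrow>
     4 \<le> r \<or> free p (last P) (hd S) \<or> free p (hd P) (last S) \<longrightarrow>
     3 * r + 5 + (if c = d then 1 else 0) \<le> 2 * n \<longrightarrow> wins N n p)"

lemma richD:
  assumes "rich N r p" "two_paths p P S" "N = length P + length S + r"
    and "c \<noteq> Green" "touched p c (hd P)" "d \<noteq> Green" "touched p d (last P)"
    and "4 \<le> r \<or> free p (last P) (hd S) \<or> free p (hd P) (last S)"
    and "3 * r + 5 + (if c = d then 1 else 0) \<le> 2 * n"
  shows "wins N n p"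
  using assms unfolding rich_def by blast

lemma rich_one: 
  fixes p :: "'a :: infinite position"
  shows "rich N 1 p"
  unfolding rich_def
proof (intro allI impI)
  fix P S :: "'a list" and c d and n :: nat
  assume A: "two_paths p P S" "N = length P + length S + 1" "c \<noteq> Green" "touched p c (hd P)"
    "d \<noteq> Green" "touched p d (last P)"
    "4 \<le> (1::nat) \<or> free p (last P) (hd S) \<or> free p (hd P) (last S)"
    "3 * 1 + 5 + (if c = d then 1 else 0) \<le> 2 * n"
  \<comment> \<open>Only one end of \<open>P\<close> receives a fresh vertex. It has to be the end
    whose joint may be occupied, and reversing both paths allows either choice.\<close>
  then consider "free p (last P) (hd S)" | "free p (hd P) (last S)" by auto
  then show "wins N n p"
  proof cases
    case 1
    then show ?thesis using A by (intro close_two_paths_one[of p P S N c n]) auto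
  next
    case 2
    then show ?thesis
      using A two_paths_rev[OF A(1)]
      by (intro close_two_paths_one[of p "rev P" "rev S" N d n])
        (auto simp: hd_rev last_rev two_paths_ends)
  qed
qed

text \<open>Nothing is known about the colours at \<open>last P\<close>, so it is extended edge by
  edge. The first wasted edge supplies the colour that \<open>rich\<close> requires without changing
  \<open>r\<close>, which is why \<open>rich\<close> is assumed for \<open>r\<close> itself. The
  constant 8 consists of the 6 for equal end colours and the 2 for the wasted move.\<close>

lemma clean_two_paths:
  fixes p :: "'a :: infinite position"
  assumes "\<And>r' (q :: 'a position). 1 \<le> r' \<Longrightarrow> r' \<le> r \<Longrightarrow> rich N r' q"
    and "two_paths p P S" "N = length P + length S + r" "1 \<le> r"
    and "c \<noteq> Green" "touched p c (hd P)" "free p (last P) (hd S)" "3 * r + 8 \<le> 2 * n"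
  shows "wins N n p"
  using assms
proof (induction r arbitrary: p P n)
  case (Suc r)
  note IH = Suc.IH and A = Suc.prems
  show ?case
  proof (cases "r = 0")
    case True
    then show ?thesis using A by (intro close_two_paths_one[of p P S N c n]) auto
  next
    case False
    obtain t where t: "t \<notin> vs p" "t \<notin> set P" "t \<notin> set S" "t \<noteq> hd P" "t \<noteq> last P" "hd P \<noteq> t" "last P \<noteq> t"
      "t \<noteq> hd S" "t \<noteq> last S" "hd S \<noteq> t" "last S \<noteq> t"
      using A(2) by (rule fresh_two_paths)
    note F = A(2-) two_paths_ends[OF A(2)] A(2)[unfolded two_paths_def] t False
    show ?thesis
    proof (rule wins_play[of _ "last P" t])
      show "wins N (n - 1) ((last P, t, Green) # p)"
        by (rule IH[of _ "P @ [t]"]; (use F A(1) in \<open>simp add: two_paths_def\<close>)?)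
    next
      fix e assume e: "e \<noteq> Green"
      have b: "3 * Suc r + 5 + (if c = e then 1 else 0) \<le> 2 * (n - 1)"
        using A(8) by auto
      show "wins N (n - 1) ((last P, t, e) # p)"
        by (rule richD[OF A(1)[of "Suc r"] _ _ _ _ _ _ _ b, of _ P S]; (use F e in \<open>simp add: two_paths_def\<close>)?)
    qed (use F in auto)
  qed
qed simp

lemma rich_three_aux:
  fixes p :: "'a :: infinite position"
  assumes A: "two_paths p P S" "N = length P + length S + 3" "c \<noteq> Green" "touched p c (hd P)"
    "d \<noteq> Green" "touched p d (last P)" "free p (last P) (hd S)" "7 \<le> n"
  shows "wins N n p"
proof (rule triangle[where d = d])
  have g: "gpath p P" "gpath p S" "P \<noteq> []" "S \<noteq> []"
    using A two_paths_ends[OF A(1)] by (auto simp: two_paths_def)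
  note F = A(2-7) two_paths_ends[OF A(1)]
  {
    fix q x y s f
    assume B: "ext p q {x, y, s}" "{x, y, s} \<inter> vs p = {}" "gpath q [x, y]" "s \<notin> {x, y}"
      "sat q s" "touched q f x" "touched q d y" "f \<noteq> Green" "f \<noteq> d"
    have Q: "two_paths q P S" "touched q c (hd P)" "touched q d (last P)"
      using ext_two_paths[OF B(1) A(1)] ext_touched[OF B(1) A(4)] ext_touched[OF B(1) A(6)] by auto
    have z: "y \<noteq> x" "x \<noteq> s" "y \<noteq> s" "s \<noteq> x" "s \<noteq> y" "s \<in> vs q" "d \<noteq> f"
      using B sat_in_vs[OF B(5)] by auto
    note F = F Q B(3)[simplified] B(4-) z Q(1)[unfolded two_paths_def]
      ext_path_facts[OF B(1,2) _ g(1,3), of x, simplified] ext_path_facts[OF B(1,2) _ g(2,4), of x, simplified]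
      ext_path_facts[OF B(1,2) _ g(1,3), of y, simplified] ext_path_facts[OF B(1,2) _ g(2,4), of y, simplified]
      ext_path_facts[OF B(1,2) _ g(1,3), of s, simplified] ext_path_facts[OF B(1,2) _ g(2,4), of s, simplified]
    let ?q = "(last P, x, Green) # q"
    have "wins N (n - 3 - 1 - 1) ((last S, s, Green) # ?q)"
      by (rule close_two_paths[of _ "P @ [x, y]" "S @ [s]"]) (use A(8) in \<open>simp_all add: F two_paths_def\<close>)
    then have "wins N (n - 3 - 1) ?q"
      by (rule wins_force_sat[of _ "last S" s, rotated -1]) (use A(8) in \<open>simp_all add: F\<close>)
    then show "wins N (n - 3) q"
      by (rule wins_force_colors[of _ d "last P" f x, rotated -1]) (use A(8) in \<open>simp_all add: F\<close>)
  next
    fix q x m y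
    assume B: "ext p q {x, m, y}" "{x, m, y} \<inter> vs p = {}" "gpath q [x, m, y]"
    have Q: "two_paths q P S" "touched q c (hd P)" "touched q d (last P)"
      using ext_two_paths[OF B(1) A(1)] ext_touched[OF B(1) A(4)] ext_touched[OF B(1) A(6)] by auto
    have "last P \<notin> {x, m, y}"
      using B(2) two_paths_ends[OF A(1)] by auto
    then have fr: "free q (last P) (hd S)"
      using ext_free[OF B(1) _ A(7)] by auto
    have z: "x \<noteq> m" "x \<noteq> y" "m \<noteq> y" "m \<noteq> x" "y \<noteq> x" "y \<noteq> m" "green q m x" "green q y m" "green q x m" "green q m y"
      using B by (auto simp: green_def)
    note F = F Q B(3)[simplified] z fr Q(1)[unfolded two_paths_def]
      ext_path_facts[OF B(1,2) _ g(1,3), of x, simplified] ext_path_facts[OF B(1,2) _ g(2,4), of x, simplified]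
      ext_path_facts[OF B(1,2) _ g(1,3), of m, simplified] ext_path_facts[OF B(1,2) _ g(2,4), of m, simplified]
      ext_path_facts[OF B(1,2) _ g(1,3), of y, simplified] ext_path_facts[OF B(1,2) _ g(2,4), of y, simplified]
    \<comment> \<open>The piece has exactly the three missing vertices. If the edge from
      \<open>hd P\<close> to \<open>x\<close> is wasted, \<open>hd P\<close> is saturated and the
      piece is attached the other way round, at \<open>y\<close>.\<close>
    have w: "wins N k q" if "4 \<le> k" for k
    proof (rule wins_play[of _ "hd P" x])
      show "wins N (k - 1) ((hd P, x, Green) # q)"
        by (rule close_two_paths[of _ "y # m # x # P" S]) (use that in \<open>simp_all add: F two_paths_def\<close>)
    next
      fix e assume e: "e \<noteq> Green" "\<not> touched q e (hd P)"
      have s: "sat ((hd P, x, e) # q) (hd P)"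
        using A Q e by (intro sat_new[of _ c]) auto
      have "wins N (k - 1 - 1) ((hd P, y, Green) # (hd P, x, e) # q)"
        by (rule close_two_paths[of _ "x # m # y # P" S]) (use that in \<open>simp_all add: F two_paths_def\<close>)
      then show "wins N (k - 1) ((hd P, x, e) # q)"
        by (rule wins_force_sat[of _ "hd P" y, rotated -1]) (use that in \<open>simp_all add: F s\<close>)
    qed (use that in \<open>simp_all add: F\<close>)
    show "wins N (n - 2) q" "wins N (n - 3) q"
      using w[of "n - 2"] w[of "n - 3"] A(8) by auto
  }
qed (use A in auto)

lemma rich_three:
  fixes p :: "'a :: infinite position"
  shows "rich N 3 p"
  unfolding rich_def
proof (intro allI impI)
  fix P S :: "'a list" and c d and n :: nat
  assume A: "two_paths p P S" "N = length P + length S + 3" "c \<noteq> Green" "touched p c (hd P)"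
    "d \<noteq> Green" "touched p d (last P)"
    "4 \<le> (3::nat) \<or> free p (last P) (hd S) \<or> free p (hd P) (last S)"
    "3 * 3 + 5 + (if c = d then 1 else 0) \<le> 2 * n"
  then consider "free p (last P) (hd S)" | "free p (hd P) (last S)" by auto
  then show "wins N n p"
  proof cases
    case 1
    then show ?thesis using A by (intro rich_three_aux[of p P S N c d n]) auto
  next
    case 2
    then show ?thesis
      using A two_paths_rev[OF A(1)]
      by (intro rich_three_aux[of p "rev P" "rev S" N d c n])
        (auto simp: hd_rev last_rev two_paths_ends)
  qed
qed

text \<open>Three vertices for four moves gain 9 - 8 = 1. Since \<open>e\<close> differs from
  \<open>d\<close>, exactly one of \<open>c = d\<close> and \<open>c = e\<close> holds, so the
  indicator flips, and the gain pays for it when it rises. The \<open>+ 3\<close> accounts for the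
  moves already spent on the piece.\<close>

lemma rich_attach:
  fixes q :: "'a :: infinite position"
  assumes "\<And>q' :: 'a position. rich N (r - 3) q'" "4 \<le> r"
    and "two_paths q P S" "N = length P + length S + r" "c \<noteq> Green" "touched q c (hd P)"
    and "d \<noteq> Green" "touched q d (last P)" "gpath q [x, m, y]" "{x, m, y} \<inter> (set P \<union> set S) = {}"
    and "free q (last P) x" "free q y (hd S)" "touched q e x" "touched q e y" "e \<noteq> Green" "e \<noteq> d"
    and "3 * r + 5 + (if c = d then 1 else 0) \<le> 2 * (n + 3)"
  shows "wins N n q"
proof -
  have ce: "(if c = d then 1 else 0) + (if c = e then 1 else 0) = (1::nat)"
    using assms nongreen_cases[of d e c] by auto
  have b: "3 * (r - 3) + 5 + (if c = e then 1 else 0) \<le> 2 * (n - 1)"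
    using assms(2,17) ce by (cases "c = d"; cases "c = e") auto
  have z: "d \<noteq> e" "last P \<noteq> x" "last P \<noteq> y" "y \<noteq> last P" "hd S \<noteq> x" "hd S \<noteq> y" "0 < n"
    using assms(2,10,16,17) two_paths_ends[OF assms(3)] by auto
  note F = assms(4-8) assms(9)[simplified] assms(10)[simplified] assms(11-16) z two_paths_ends[OF assms(3)] assms(3)[unfolded two_paths_def]
  have "wins N (n - 1) ((last P, x, Green) # q)"
    by (rule richD[OF assms(1) _ _ _ _ _ _ _ b, of _ "P @ [x, m, y]" S])
      (use assms(2) in \<open>simp_all add: F two_paths_def\<close>)
  then show ?thesis
    by (rule wins_force_colors[of q d "last P" e x, rotated -1]) (simp_all add: F)
qed

lemma rich_step:
  fixes p :: "'a :: infinite position"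
  assumes IH: "\<And>r' (q :: 'a position). 1 \<le> r' \<Longrightarrow> r' < r \<Longrightarrow> rich N r' q" and r: "4 \<le> r"
  shows "rich N r p"
  unfolding rich_def
proof (intro allI impI)
  fix P S :: "'a list" and c d and n :: nat
  assume A: "two_paths p P S" "N = length P + length S + r" "c \<noteq> Green" "touched p c (hd P)"
    "d \<noteq> Green" "touched p d (last P)" "3 * r + 5 + (if c = d then 1 else 0) \<le> 2 * n"
  have g: "gpath p P" "gpath p S" "P \<noteq> []" "S \<noteq> []"
    using A two_paths_ends[OF A(1)] by (auto simp: two_paths_def)
  have n: "8 < n"
    using A(7) r by (auto split: if_splits)
  have IH3: "rich N (r - 3) q" for q :: "'a position"
    using IH[of "r - 3" q] r by simp
  note F = A(2-6) two_paths_ends[OF A(1)]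
  show "wins N n p"
  proof (rule triangle[where d = d])
    fix q x y s f
    assume B: "ext p q {x, y, s}" "{x, y, s} \<inter> vs p = {}" "gpath q [x, y]" "s \<notin> {x, y}"
      "sat q s" "touched q f x" "touched q d y" "f \<noteq> Green" "f \<noteq> d"
    have Q: "two_paths q P S" "touched q c (hd P)" "touched q d (last P)"
      using ext_two_paths[OF B(1) A(1)] ext_touched[OF B(1) A(4)] ext_touched[OF B(1) A(6)] by auto
    have z: "y \<noteq> x" "x \<noteq> s" "y \<noteq> s" "s \<noteq> x" "s \<noteq> y" "s \<in> vs q" "d \<noteq> f"
      using B sat_in_vs[OF B(5)] by auto
    note F = F Q B(3)[simplified] B(4-) z Q(1)[unfolded two_paths_def]
      ext_path_facts[OF B(1,2) _ g(1,3), of x, simplified] ext_path_facts[OF B(1,2) _ g(2,4), of x, simplified]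
      ext_path_facts[OF B(1,2) _ g(1,3), of y, simplified] ext_path_facts[OF B(1,2) _ g(2,4), of y, simplified]
      ext_path_facts[OF B(1,2) _ g(1,3), of s, simplified] ext_path_facts[OF B(1,2) _ g(2,4), of s, simplified]
    let ?q = "(last P, x, Green) # q"
    have "two_paths ?q P S" using Q by (simp add: two_paths_def)
    then obtain w where w: "w \<notin> vs ?q" "w \<notin> set P" "w \<notin> set S" "w \<noteq> hd P" "w \<noteq> last P" "hd P \<noteq> w" "last P \<noteq> w"
      "w \<noteq> hd S" "w \<noteq> last S" "hd S \<noteq> w" "last S \<noteq> w"
      by (rule fresh_two_paths)
    have w': "w \<noteq> s" "w \<noteq> x" "w \<noteq> y" "s \<noteq> w" "x \<noteq> w" "y \<noteq> w"
      using w B z by auto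
    note F = F w[simplified] w'
    \<comment> \<open>The fresh \<open>w\<close> between \<open>S\<close> and \<open>s\<close> makes
      two forced moves yield two vertices. Altogether six moves give four vertices, the exact rate,
      and the end colours stay \<open>c\<close> and \<open>d\<close>.\<close>
    let ?r = "(w, s, Green) # (last S, w, Green) # ?q"
    have R: "two_paths ?r (P @ [x, y]) (S @ [w, s])"
      by (simp add: F two_paths_def)
    have "wins N (n - 3 - 1 - 1 - 1) ?r"
    \<comment> \<open>For \<open>r = 4\<close> nothing is missing any more, which
      \<open>rich\<close> does not cover. Both closing edges have a new vertex as one end and an old
      one as the other, so they are free.\<close>
    proof (cases "r = 4")
      case True
      then show ?thesis
        by (intro close_two_paths[OF R]) (use r n in \<open>simp_all add: F\<close>)
    next
      case False
      have b: "3 * (r - 4) + 5 + (if c = d then 1 else 0) \<le> 2 * (n - 3 - 1 - 1 - 1)"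
        using A(7) r by (cases "c = d") auto
      have "rich N (r - 4) ?r"
        using IH r False by simp
      then show ?thesis
        by (rule richD[OF _ R _ _ _ _ _ _ b]) (use r n in \<open>simp_all add: F\<close>)
    qed
    then have "wins N (n - 3 - 1 - 1) ((last S, w, Green) # ?q)"
      by (rule wins_force_sat[of _ w s, rotated -1]) (use r n in \<open>simp_all add: F\<close>)
    then have "wins N (n - 3 - 1) ?q"
      by (rule wins_force_sat[of _ "last S" w, rotated -1]) (use r n in \<open>simp_all add: F\<close>)
    then show "wins N (n - 3) q"
      by (rule wins_force_colors[of _ d "last P" f x, rotated -1]) (use r n in \<open>simp_all add: F\<close>)
  next
    fix q x m y e
    assume B: "ext p q {x, m, y}" "{x, m, y} \<inter> vs p = {}" "gpath q [x, m, y]"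
      "touched q e x" "touched q e y" "e \<noteq> Green"
    have Q: "two_paths q P S" "touched q c (hd P)" "touched q d (last P)"
      using ext_two_paths[OF B(1) A(1)] ext_touched[OF B(1) A(4)] ext_touched[OF B(1) A(6)] by auto
    have z: "x \<noteq> m" "x \<noteq> y" "m \<noteq> y" "m \<noteq> x" "y \<noteq> x" "y \<noteq> m" "green q m x" "green q y m" "green q x m" "green q m y"
      using B by (auto simp: green_def)
    note F = F Q B(3)[simplified] B(4-) z Q(1)[unfolded two_paths_def]
      ext_path_facts[OF B(1,2) _ g(1,3), of x, simplified] ext_path_facts[OF B(1,2) _ g(2,4), of x, simplified]
      ext_path_facts[OF B(1,2) _ g(1,3), of m, simplified] ext_path_facts[OF B(1,2) _ g(2,4), of m, simplified]
      ext_path_facts[OF B(1,2) _ g(1,3), of y, simplified] ext_path_facts[OF B(1,2) _ g(2,4), of y, simplified]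
    consider "e \<noteq> d" | "e \<noteq> c" | "e = c" "e = d" by auto
    then show "wins N (n - 3) q"
    proof cases
      case 1
      have b: "3 * r + 5 + (if c = d then 1 else 0) \<le> 2 * (n - 3 + 3)"
        using A(7) n by simp
      show ?thesis
        by (rule rich_attach[OF IH3 r Q(1) _ _ _ _ _ _ _ _ _ _ _ _ _ b, of x m y e]) (use r n 1 in \<open>simp_all add: F\<close>)
    next
      case 2
      have b: "3 * r + 5 + (if d = c then 1 else 0) \<le> 2 * (n - 3 + 3)"
        using A(7) n by (simp add: eq_commute)
      show ?thesis
        by (rule rich_attach[OF IH3 r two_paths_rev[OF Q(1)] _ _ _ _ _ _ _ _ _ _ _ _ _ b, of x m y e])
          (use r n 2 in \<open>simp_all add: F hd_rev last_rev\<close>)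
    next
      case 3
      show ?thesis
      proof (rule wins_play[of _ "last P" x])
        have b: "3 * (r - 3) + 5 + (if c = d then 1 else 0) \<le> 2 * (n - 3 - 1)"
          using A(7) r 3 by simp
        show "wins N (n - 3 - 1) ((last P, x, Green) # q)"
          by (rule richD[OF IH3 _ _ _ _ _ _ _ b, of _ "P @ [x, m, y]" S])
            (use r n 3 B(5) in \<open>simp_all add: F two_paths_def\<close>)
      next
        fix h assume h: "h \<noteq> Green" "\<not> touched q h (last P)"
        have s: "sat ((last P, x, h) # q) (last P)"
          using A Q h by (intro sat_new[of _ d]) auto
        \<comment> \<open>Three vertices have cost five moves, a loss of 1. The new end
          \<open>x\<close> shows \<open>h\<close>, so the end colours become different, and the
          allowance for equal colours pays the loss.\<close>
        have "c \<noteq> h" using h 3 Q by auto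
        then have b: "3 * (r - 3) + 5 + (if c = h then 1 else 0) \<le> 2 * (n - 3 - 1 - 1)"
          using A(7) r 3 by simp
        have "wins N (n - 3 - 1 - 1) ((last P, y, Green) # (last P, x, h) # q)"
          by (rule richD[OF IH3 _ _ _ _ _ _ _ b, of _ "P @ [y, m, x]" S])
            (use r n h in \<open>simp_all add: F two_paths_def\<close>)
        then show "wins N (n - 3 - 1) ((last P, x, h) # q)"
          by (rule wins_force_sat[of _ "last P" y, rotated -1]) (use r n s in \<open>simp_all add: F\<close>)
      qed (use r n in \<open>simp_all add: F\<close>)
    qed
  next
    fix q x m y
    assume B: "ext p q {x, m, y}" "{x, m, y} \<inter> vs p = {}" "gpath q [x, m, y]"
    have Q: "two_paths q P S" "touched q c (hd P)" "touched q d (last P)"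
      using ext_two_paths[OF B(1) A(1)] ext_touched[OF B(1) A(4)] ext_touched[OF B(1) A(6)] by auto
    have z: "x \<noteq> m" "x \<noteq> y" "m \<noteq> y" "m \<noteq> x" "y \<noteq> x" "y \<noteq> m" "green q m x" "green q y m" "green q x m" "green q m y"
      using B by (auto simp: green_def)
    note F = F Q B(3)[simplified] z Q(1)[unfolded two_paths_def]
      ext_path_facts[OF B(1,2) _ g(1,3), of x, simplified] ext_path_facts[OF B(1,2) _ g(2,4), of x, simplified]
      ext_path_facts[OF B(1,2) _ g(1,3), of m, simplified] ext_path_facts[OF B(1,2) _ g(2,4), of m, simplified]
      ext_path_facts[OF B(1,2) _ g(1,3), of y, simplified] ext_path_facts[OF B(1,2) _ g(2,4), of y, simplified]
    show "wins N (n - 2) q"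
    proof (rule wins_play[of _ "last P" x])
      have b: "3 * (r - 3) + 8 \<le> 2 * (n - 2 - 1)"
        using A(7) r by (auto split: if_splits)
      have "rich N r' q" if "1 \<le> r'" "r' \<le> r - 3" for r' and q :: "'a position"
        using IH that r by auto
      then show "wins N (n - 2 - 1) ((last P, x, Green) # q)"
        by (rule clean_two_paths[of "r - 3" N _ "P @ [x, m, y]" S c])
          (use r n b in \<open>simp_all add: F two_paths_def\<close>)
    next
      fix h assume h: "h \<noteq> Green" "\<not> touched q h (last P)"
      have s: "sat ((last P, x, h) # q) (last P)"
        using A Q h by (intro sat_new[of _ d]) auto
      have "d \<noteq> h" using h Q by auto
      then have b: "3 * (r - 3) + 5 + (if c = h then 1 else 0) \<le> 2 * (n - 2 - 1 - 1)"
        using A(7) r by (cases "c = d"; cases "c = h") auto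
      have "wins N (n - 2 - 1 - 1) ((last P, y, Green) # (last P, x, h) # q)"
        by (rule richD[OF IH3 _ _ _ _ _ _ _ b, of _ "P @ [y, m, x]" S])
          (use r n h in \<open>simp_all add: F two_paths_def\<close>)
      then show "wins N (n - 2 - 1) ((last P, x, h) # q)"
        by (rule wins_force_sat[of _ "last P" y, rotated -1]) (use r n s in \<open>simp_all add: F\<close>)
    qed (use r n in \<open>simp_all add: F\<close>)
  qed (use A n in auto)
qed

lemma rich_all:
  fixes p :: "'a :: infinite position"
  assumes "1 \<le> r"
  shows "rich N r p"
  using assms
proof (induction r arbitrary: p rule: less_induct)
  case (less r p)
  consider "r = 1" | "r = 2" | "r = 3" | "4 \<le> r"
    using less.prems by linarith
  then show ?case
  proof cases
    case 1
    show ?thesis unfolding 1 by (rule rich_one)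
  next
    case 2
    show ?thesis
      unfolding rich_def 2
    proof (intro allI impI)
      fix P S :: "'a list" and c d and n :: nat
      assume A: "two_paths p P S" "N = length P + length S + 2" "c \<noteq> Green" "touched p c (hd P)"
        "d \<noteq> Green" "touched p d (last P)" "3 * 2 + 5 + (if c = d then 1 else 0) \<le> 2 * n"
      have "6 \<le> n"
        using A(7) by (simp split: if_splits)
      with A(1-6) show "wins N n p"
        by (rule close_two_paths_two)
    qed
  next
    case 3
    show ?thesis unfolding 3 by (rule rich_three)
  next
    case 4
    show ?thesis
      by (rule rich_step[OF less.IH 4])
  qed
qed

section \<open>One green path\<close>

text \<open>The analogue of \<open>rich\<close> before any saturated vertex is available: \<open>P\<close> lacks \<open>r\<close> edges, and the
  bound says that twice the number of wasted edges is at most the number of edges of \<open>P\<close>, minus one if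
  the colours of the ends differ.\<close>

definition poor :: "nat \<Rightarrow> nat \<Rightarrow> 'a position \<Rightarrow> bool" where
  "poor N r p \<longleftrightarrow> (\<forall>P c d n. gpath p P \<longrightarrow> 2 \<le> length P \<longrightarrow> N + 1 = length P + r \<longrightarrow>
     c \<noteq> Green \<longrightarrow> touched p c (hd P) \<longrightarrow> d \<noteq> Green \<longrightarrow> touched p d (last P) \<longrightarrow>
     3 * r + 2 + (if c = d then 0 else 1) \<le> 2 * n \<longrightarrow> wins N n p)"

lemma poorD:
  assumes "poor N r p" "gpath p P" "2 \<le> length P" "N + 1 = length P + r"
    and "c \<noteq> Green" "touched p c (hd P)" "d \<noteq> Green" "touched p d (last P)"
    and "3 * r + 2 + (if c = d then 0 else 1) \<le> 2 * n"
  shows "wins N n p"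
  using assms unfolding poor_def by blast

text \<open>For \<open>r\<close> = 2, 3, 4 the bound yields at least 4, 6, 7 moves if the end
  colours agree and 5, 6, 8 if they differ. These remainders are too short for a piece: subtracting
  3 or 4 would leave the range of \<open>poor\<close> or \<open>rich\<close>.\<close>

lemma poor_small:
  fixes p :: "'a :: infinite position"
  assumes "r \<in> {2, 3, 4}"
  shows "poor N r p"
  unfolding poor_def
proof (intro allI impI)
  fix P :: "'a list" and c d and n :: nat
  assume A: "gpath p P" "2 \<le> length P" "N + 1 = length P + r" "c \<noteq> Green" "touched p c (hd P)"
    "d \<noteq> Green" "touched p d (last P)" "3 * r + 2 + (if c = d then 0 else 1) \<le> 2 * n"
  consider "r = 2" | "r = 3" | "r = 4" "c = d" | "r = 4" "c \<noteq> d"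
    using assms by auto
  then show "wins N n p"
  proof cases
    case 1
    show ?thesis
      by (rule close_two_unit[of p P N c d]) (use A 1 in \<open>simp_all split: if_splits\<close>)
  next
    case 2
    show ?thesis
      by (rule close_three[of p P N c d]) (use A 2 in \<open>simp_all split: if_splits\<close>)
  next
    case 3
    show ?thesis
      by (rule close_four_same[of p P N c]) (use A 3 in simp_all)
  next
    case 4
    show ?thesis
      by (rule close_four_distinct[of p P N c d]) (use A 4 in simp_all)
  qed
qed

text \<open>The end \<open>last P\<close> is extended until an edge is wasted there. If its colour
  is that of \<open>hd P\<close>, the good state of \<open>poor\<close> is reached and the constant
  4 pays for the move.\<close>

lemma clean_path:
  fixes p :: "'a :: infinite position"
  assumes "\<And>r' (q :: 'a position). 2 \<le> r' \<Longrightarrow> r' \<le> r \<Longrightarrow> poor N r' q"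
    and "gpath p P" "2 \<le> length P" "N + 1 = length P + r" "2 \<le> r"
    and "c \<noteq> Green" "touched p c (hd P)" "3 * r + 4 \<le> 2 * n"
  shows "wins N n p"
  using assms
proof (induction r arbitrary: p P n)
  case (Suc r)
  note IH = Suc.IH and A = Suc.prems
  show ?case
  proof (cases "r = 1")
    case True
    show ?thesis
      by (rule close_two_clean[of p P N c]) (use A(2-) True in simp_all)
  next
    case False
    obtain t where t: "t \<notin> vs p" "t \<notin> set P" "t \<noteq> hd P" "t \<noteq> last P" "hd P \<noteq> t" "last P \<noteq> t"
      using A(2,3) by (rule fresh_for_path)
    have r: "2 \<le> r" "4 < n" using A(5,8) False by auto
    note F = A(2,6,7) gpath_ends[OF A(2,3)] t
    have A1: "poor N r' q" if "2 \<le> r'" "r' \<le> r" for r' and q :: "'a position"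
      using that by (intro A(1)) simp_all
    show ?thesis
    proof (rule wins_play[of _ "last P" t])
      show "wins N (n - 1) ((last P, t, Green) # p)"
        by (rule IH[where P = "P @ [t]", OF A1]) (use A(3,4,8) r in \<open>simp_all add: F\<close>)
    next
      fix e assume e: "e \<noteq> Green"
      show "wins N (n - 1) ((last P, t, e) # p)"
      proof (cases "c = e")
        case True
        then have b: "3 * Suc r + 2 + (if c = e then 0 else 1) \<le> 2 * (n - 1)"
          using A(8) by simp
        show ?thesis
          by (rule poorD[OF A(1) _ _ _ _ _ _ _ b, of _ P])
            (use A(3,4) e r in \<open>simp_all add: F\<close>)
      next
        case False
        \<comment> \<open>With different colours, \<open>t\<close> is forced onto the head of the
          path, so the wasted edge itself equips both new ends with \<open>e\<close>.\<close>
        have b: "3 * r + 2 + (if e = e then 0 else 1) \<le> 2 * (n - 1 - 1)"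
          using A(8) by simp
        have "wins N (n - 1 - 1) ((hd P, t, Green) # (last P, t, e) # p)"
          by (rule poorD[OF A(1) _ _ _ _ _ _ _ b, of _ "t # P"])
            (use A(3,4) e r in \<open>simp_all add: F\<close>)
        then show ?thesis
          by (rule wins_force_colors[of _ c "hd P" e t, rotated -1])
            (use e False r in \<open>simp_all add: F\<close>)
      qed
    qed (use r in \<open>simp_all add: F\<close>)
  qed
qed simp

text \<open>The same flip of the indicator as for two paths, but here it penalises different end
  colours; the gain of 1 from three edges in four moves pays when equal colours turn into different
  ones.\<close>

lemma poor_attach:
  fixes q :: "'a :: infinite position"
  assumes "\<And>q' :: 'a position. poor N (r - 3) q'" "5 \<le> r"
    and "gpath q P" "2 \<le> length P" "N + 1 = length P + r" "c \<noteq> Green" "touched q c (hd P)"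
    and "d \<noteq> Green" "touched q d (last P)" "gpath q [x, m, y]" "{x, m, y} \<inter> set P = {}"
    and "free q (last P) x" "touched q e x" "touched q e y" "e \<noteq> Green" "e \<noteq> d"
    and "3 * r + 2 + (if c = d then 0 else 1) \<le> 2 * (n + 3)"
  shows "wins N n q"
proof -
  have ce: "(if c = d then 0 else 1) + (if c = e then 0 else 1) = (1::nat)"
    using assms(6,8,15,16) nongreen_cases[of d e c] by auto
  have b: "3 * (r - 3) + 2 + (if c = e then 0 else 1) \<le> 2 * (n - 1)"
    using assms(2,17) ce by (cases "c = d"; cases "c = e") auto
  have z: "d \<noteq> e" "last P \<noteq> x" "last P \<noteq> y" "y \<noteq> last P" "0 < n"
    using assms(2,11,16,17) gpath_ends[OF assms(3,4)] by auto
  note F = assms(3,6-9) assms(10)[simplified] assms(11)[simplified] assms(12-16) z gpath_ends[OF assms(3,4)]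
  have "wins N (n - 1) ((last P, x, Green) # q)"
    by (rule poorD[OF assms(1) _ _ _ _ _ _ _ b, of _ "P @ [x, m, y]"])
      (use assms(2,4,5) in \<open>simp_all add: F\<close>)
  then show ?thesis
    by (rule wins_force_colors[of q d "last P" e x, rotated -1]) (simp_all add: F)
qed

lemma poor_step:
  fixes p :: "'a :: infinite position"
  assumes IH: "\<And>r' (q :: 'a position). 2 \<le> r' \<Longrightarrow> r' < r \<Longrightarrow> poor N r' q" and r: "5 \<le> r"
  shows "poor N r p"
  unfolding poor_def
proof (intro allI impI)
  fix P :: "'a list" and c d and n :: nat
  assume A: "gpath p P" "2 \<le> length P" "N + 1 = length P + r" "c \<noteq> Green" "touched p c (hd P)"
    "d \<noteq> Green" "touched p d (last P)" "3 * r + 2 + (if c = d then 0 else 1) \<le> 2 * n"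
  have n: "8 < n"
    using A(8) r by (auto split: if_splits)
  have IH3: "poor N (r - 3) q" for q :: "'a position"
    using IH[of "r - 3" q] r by simp
  note g = gpath_ends[OF A(1,2)]
  note F = A(4-7) g
  note L = A(2,3) r n
  show "wins N n p"
  proof (rule triangle[where d = d])
    fix q x y s f
    assume B: "ext p q {x, y, s}" "{x, y, s} \<inter> vs p = {}" "gpath q [x, y]" "s \<notin> {x, y}"
      "sat q s" "touched q f x" "touched q d y" "f \<noteq> Green" "f \<noteq> d"
    have Q: "gpath q P" "touched q c (hd P)" "touched q d (last P)"
      using ext_gpath[OF B(1) A(1)] ext_touched[OF B(1) A(5)] ext_touched[OF B(1) A(7)] by auto
    have z: "y \<noteq> x" "x \<noteq> s" "y \<noteq> s" "s \<noteq> x" "s \<noteq> y" "s \<in> vs q" "d \<noteq> f"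
      using B sat_in_vs[OF B(5)] by auto
    note F = F Q B(3)[simplified] B(4-) z
      ext_path_facts[OF B(1,2) _ A(1) g(1), of x, simplified] ext_path_facts[OF B(1,2) _ A(1) g(1), of y, simplified]
      ext_path_facts[OF B(1,2) _ A(1) g(1), of s, simplified]
    let ?q = "(last P, x, Green) # q"
    \<comment> \<open>The saturated \<open>s\<close> becomes the second path without a further move.
      The shift by 4 arises because three vertices are new and \<open>rich\<close> counts missing
      vertices where \<open>poor\<close> counts missing edges.\<close>
    have b: "3 * (r - 4) + 5 + (if c = d then 1 else 0) \<le> 2 * (n - 3 - 1)"
      using A(8) r by (cases "c = d") auto
    have "rich N (r - 4) ?q"
      using r by (intro rich_all) simp
    then have "wins N (n - 3 - 1) ?q"
      by (rule richD[where P = "P @ [x, y]" and S = "[s]", OF _ _ _ _ _ _ _ _ b])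
        (use L in \<open>simp_all add: F two_paths_def\<close>)
    then show "wins N (n - 3) q"
      by (rule wins_force_colors[of _ d "last P" f x, rotated -1]) (use L in \<open>simp_all add: F\<close>)
  next
    fix q x m y e
    assume B: "ext p q {x, m, y}" "{x, m, y} \<inter> vs p = {}" "gpath q [x, m, y]"
      "touched q e x" "touched q e y" "e \<noteq> Green"
    have Q: "gpath q P" "touched q c (hd P)" "touched q d (last P)"
      using ext_gpath[OF B(1) A(1)] ext_touched[OF B(1) A(5)] ext_touched[OF B(1) A(7)] by auto
    have z: "x \<noteq> m" "x \<noteq> y" "m \<noteq> y" "m \<noteq> x" "y \<noteq> x" "y \<noteq> m" "green q m x" "green q y m" "green q x m" "green q m y"
      using B by (auto simp: green_def)
    note F = F Q B(3)[simplified] B(4-) z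
      ext_path_facts[OF B(1,2) _ A(1) g(1), of x, simplified] ext_path_facts[OF B(1,2) _ A(1) g(1), of m, simplified]
      ext_path_facts[OF B(1,2) _ A(1) g(1), of y, simplified]
    consider "e \<noteq> d" | "e \<noteq> c" | "e = c" "e = d" by auto
    then show "wins N (n - 3) q"
    proof cases
      case 1
      have b: "3 * r + 2 + (if c = d then 0 else 1) \<le> 2 * (n - 3 + 3)"
        using A(8) n by simp
      show ?thesis
        by (rule poor_attach[OF IH3 r Q(1) _ _ _ _ _ _ _ _ _ _ _ _ _ b, of x m y e])
          (use L 1 in \<open>simp_all add: F\<close>)
    next
      case 2
      have b: "3 * r + 2 + (if d = c then 0 else 1) \<le> 2 * (n - 3 + 3)"
        using A(8) n by (simp add: eq_commute)
      have "gpath q (rev P)" using Q by simp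
      then show ?thesis
        by (rule poor_attach[where P = "rev P" and x = x and m = m and y = y and e = e, OF IH3 r _ _ _ _ _ _ _ _ _ _ _ _ _ _ b])
          (use L 2 in \<open>simp_all add: F hd_rev last_rev\<close>)
    next
      case 3
      show ?thesis
      proof (rule wins_play[of _ "last P" x])
        have b: "3 * (r - 3) + 2 + (if c = e then 0 else 1) \<le> 2 * (n - 3 - 1)"
          using A(8) r 3 by simp
        show "wins N (n - 3 - 1) ((last P, x, Green) # q)"
          by (rule poorD[OF IH3 _ _ _ _ _ _ _ b, of _ "P @ [x, m, y]"])
            (use L in \<open>simp_all add: F\<close>)
      next
        fix h assume h: "h \<noteq> Green" "\<not> touched q h (last P)" "\<not> touched q h x"
        let ?q = "(last P, x, h) # q"
        have s: "sat ?q (last P)" "sat ?q x"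
          using sat_new[OF Q(3) h(2,1) A(6)] sat_new[OF B(4) h(3,1) B(6)] by auto
        show "wins N (n - 3 - 1) ?q"
        \<comment> \<open>For \<open>r = 5\<close> a detour through a fresh vertex would leave only
          one missing edge, below the range of \<open>poor\<close>; there the piece is linked
          directly at \<open>y\<close> and one vertex remains.\<close>
        proof (cases "r = 5")
          case True
          have "wins N (n - 3 - 1 - 1) ((last P, y, Green) # ?q)"
            by (rule close_two_unit[of _ "P @ [y, m, x]" _ c h]) (use L h True in \<open>simp_all add: F\<close>)
          then show ?thesis
            by (rule wins_force_sat[of _ "last P" y, rotated -1]) (use L in \<open>simp_all add: F s\<close>)
        next
          case False
          obtain w where "w \<notin> vs ((x, m, Green) # (m, y, Green) # ?q)" by (rule fresh_vertex)
          then have w: "w \<notin> vs q" "w \<noteq> x" "w \<noteq> m" "w \<noteq> y" "x \<noteq> w" "m \<noteq> w" "y \<noteq> w"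
            "w \<noteq> last P" "last P \<noteq> w" "w \<notin> set P"
            using gpath_subset[OF Q(1)] by auto
          \<comment> \<open>The failed link has saturated both \<open>last P\<close> and
            \<open>x\<close>, so \<open>w\<close> fits between them by two forced edges: four path
            edges for six moves, with equal colours at the ends as before.\<close>
          have b: "3 * (r - 4) + 2 + (if c = e then 0 else 1) \<le> 2 * (n - 3 - 1 - 1 - 1)"
            using A(8) r 3 by simp
          have "poor N (r - 4) ((w, x, Green) # (last P, w, Green) # ?q)"
            using r False by (intro IH) simp_all
          then have "wins N (n - 3 - 1 - 1 - 1) ((w, x, Green) # (last P, w, Green) # ?q)"
            by (rule poorD[where P = "P @ [w, x, m, y]", OF _ _ _ _ _ _ _ _ b])
              (use L in \<open>simp_all add: F w\<close>)
          then have "wins N (n - 3 - 1 - 1) ((last P, w, Green) # ?q)"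
            by (rule wins_force_sat[of _ w x, rotated -1]) (use L in \<open>simp_all add: F s w\<close>)
          then show ?thesis
            by (rule wins_force_sat[of _ "last P" w, rotated -1]) (use L in \<open>simp_all add: F s w\<close>)
        qed
      qed (use L in \<open>simp_all add: F\<close>)
    qed
  next
    fix q x m y
    assume B: "ext p q {x, m, y}" "{x, m, y} \<inter> vs p = {}" "gpath q [x, m, y]"
    have Q: "gpath q P" "touched q c (hd P)" "touched q d (last P)"
      using ext_gpath[OF B(1) A(1)] ext_touched[OF B(1) A(5)] ext_touched[OF B(1) A(7)] by auto
    have z: "x \<noteq> m" "x \<noteq> y" "m \<noteq> y" "m \<noteq> x" "y \<noteq> x" "y \<noteq> m" "green q m x" "green q y m" "green q x m" "green q m y"
      using B by (auto simp: green_def)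
    note F = F Q B(3)[simplified] z
      ext_path_facts[OF B(1,2) _ A(1) g(1), of x, simplified] ext_path_facts[OF B(1,2) _ A(1) g(1), of m, simplified]
      ext_path_facts[OF B(1,2) _ A(1) g(1), of y, simplified]
    show "wins N (n - 2) q"
    proof (rule wins_play[of _ "last P" x])
      have b: "3 * (r - 3) + 4 \<le> 2 * (n - 2 - 1)"
        using A(8) r by (auto split: if_splits)
      have "poor N r' q" if "2 \<le> r'" "r' \<le> r - 3" for r' and q :: "'a position"
        using IH that r by auto
      then show "wins N (n - 2 - 1) ((last P, x, Green) # q)"
        by (rule clean_path[of "r - 3" N _ "P @ [x, m, y]" c])
          (use L b in \<open>simp_all add: F\<close>)
    next
      fix h assume h: "h \<noteq> Green" "\<not> touched q h (last P)"
      have s: "sat ((last P, x, h) # q) (last P)"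
        using sat_new[OF Q(3) h(2,1) A(6)] by auto
      have dh: "d \<noteq> h" using h Q by auto
      have b: "3 * (r - 3) + 2 + (if c = h then 0 else 1) \<le> 2 * (n - 2 - 1 - 1)"
        using A(8) r dh nongreen_cases[OF A(6) h(1) dh A(4)] by (cases "c = d"; cases "c = h") auto
      have "wins N (n - 2 - 1 - 1) ((last P, y, Green) # (last P, x, h) # q)"
        by (rule poorD[OF IH3 _ _ _ _ _ _ _ b, of _ "P @ [y, m, x]"])
          (use L h in \<open>simp_all add: F\<close>)
      then show "wins N (n - 2 - 1) ((last P, x, h) # q)"
        by (rule wins_force_sat[of _ "last P" y, rotated -1]) (use L in \<open>simp_all add: F s\<close>)
    qed (use L in \<open>simp_all add: F\<close>)
  qed (use A n in auto)
qed

lemma poor_all: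
  fixes p :: "'a :: infinite position"
  assumes "2 \<le> r"
  shows "poor N r p"
  using assms
proof (induction r arbitrary: p rule: less_induct)
  case (less r p)
  show ?case
  proof (cases "5 \<le> r")
    case True
    show ?thesis
      by (rule poor_step[OF less.IH True])
  next
    case False
    then have "r \<in> {2, 3, 4}" using less.prems by auto
    then show ?thesis by (rule poor_small)
  qed
qed

text \<open>No edge has been wasted yet, so for \<open>k \<ge> 4\<close> at least nine spare moves are left.\<close>

lemma green_path_wins:
  fixes p :: "'a :: infinite position"
  assumes "gpath p P" "2 \<le> length P" "N + 1 = length P + r" "2 \<le> r" "3 * r + 4 \<le> 2 * n" "r + 9 \<le> n"
  shows "wins N n p"
  using assms
proof (induction r arbitrary: p P n)
  case (Suc r)
  note IH = Suc.IH and A = Suc.prems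
  obtain t where t: "t \<notin> vs p" "t \<notin> set P" "t \<noteq> hd P" "t \<noteq> last P" "hd P \<noteq> t" "last P \<noteq> t"
    using A(1,2) by (rule fresh_for_path)
  note F = A(1) gpath_ends[OF A(1,2)] t
  note L = A(2-6)
  show ?case
  proof (rule wins_play[of _ "last P" t])
    let ?p = "(last P, t, Green) # p"
    show "wins N (n - 1) ?p"
    proof (cases "r = 1")
      case True
      show ?thesis
      \<comment> \<open>Only the closing edge is missing. If it is wasted, \<open>t\<close> is given
        up and \<open>P\<close> is closed through another vertex, at the expense of the spare
        moves.\<close>
      proof (rule wins_play[of _ t "hd P"])
        show "wins N (n - 1 - 1) ((t, hd P, Green) # ?p)"
          by (rule wins_cycle[of _ "P @ [t]"]) (use L True in \<open>simp_all add: F\<close>)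
      next
        fix e assume "e \<noteq> Green"
        then show "wins N (n - 1 - 1) ((t, hd P, e) # ?p)"
          by (intro close_two_clean[of _ P N e]) (use L True in \<open>simp_all add: F\<close>)
      qed (use L in \<open>simp_all add: F\<close>)
    next
      case False
      then show ?thesis
        by (intro IH[of _ "P @ [t]"]) (use L in \<open>simp_all add: F\<close>)
    qed
  next
    fix e assume e: "e \<noteq> Green"
    let ?p = "(last P, t, e) # p"
    show "wins N (n - 1) ?p"
    \<comment> \<open>Below six the spare moves cover the bound of \<open>clean_path\<close>. From
      six on, \<open>t\<close> may become a saturated vertex with wasted edges to both ends of
      \<open>P\<close>; no joint is free then, and \<open>rich\<close> accepts this because
      \<open>r - 1\<close> is at least 4.\<close>
    proof (cases "Suc r < 6")
      case True
      have "poor N r' q" if "2 \<le> r'" for r' and q :: "'a position"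
        using that by (rule poor_all)
      then show ?thesis
        by (rule clean_path[of "Suc r" N ?p "rev P" e]) (use L e True in \<open>simp_all add: F hd_rev last_rev\<close>)
    next
      case False
      show ?thesis
      proof (rule wins_play[of _ t "hd P"])
        have b: "3 * r + 2 + (if e = e then 0 else 1) \<le> 2 * (n - 1 - 1)"
          using L by simp
        have "poor N r ((t, hd P, Green) # ?p)"
          using False by (intro poor_all) simp
        then show "wins N (n - 1 - 1) ((t, hd P, Green) # ?p)"
          by (rule poorD[where P = "t # P", OF _ _ _ _ _ _ _ _ b]) (use L e in \<open>simp_all add: F\<close>)
      next
        fix f assume f: "f \<noteq> Green" "\<not> touched ?p f t"
        have s: "sat ((t, hd P, f) # ?p) t"
          using e f by (intro sat_new[of _ e]) auto
        have fe: "f \<noteq> e" using f by auto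
        have b: "3 * (r - 1) + 5 + (if f = e then 1 else 0) \<le> 2 * (n - 1 - 1)"
          using L fe False by simp
        have "rich N (r - 1) ((t, hd P, f) # ?p)"
          using False by (intro rich_all) simp
        then show "wins N (n - 1 - 1) ((t, hd P, f) # ?p)"
          by (rule richD[where P = P and S = "[t]", OF _ _ _ _ _ _ _ _ b])
            (use L e f False in \<open>simp_all add: F s two_paths_def\<close>)
      qed (use L in \<open>simp_all add: F\<close>)
    qed
  qed (use L in \<open>simp_all add: F\<close>)
qed simp

text \<open>The three outcomes of the first piece start the three regimes: one saturated vertex,
  equal end colours, no waste. In each, the doubled count is met exactly.\<close>

lemma wins_from_start:
  assumes k: "4 \<le> k"
  shows "wins (4 * k) (6 * k + 1) ([] :: 'a :: infinite position)"
proof (rule triangle[where d = Red])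
  let ?N = "4 * k" and ?n = "6 * k + 1"
  {
    fix q :: "'a position" and x y s c
    assume B: "gpath q [x, y]" "s \<notin> {x, y}" "sat q s" "touched q c x" "touched q Red y" "c \<noteq> Green" "c \<noteq> Red"
    have b: "3 * (4 * k - 3) + 5 + (if c = Red then 1 else 0) \<le> 2 * (?n - 3)"
      using k B by simp
    have "rich ?N (4 * k - 3) q"
      using k by (intro rich_all) simp
    then show "wins ?N (?n - 3) q"
      by (rule richD[where P = "[x, y]" and S = "[s]", OF _ _ _ _ _ _ _ _ b])
        (use B k sat_in_vs[OF B(3)] in \<open>auto simp: two_paths_def\<close>)
  next
    fix q :: "'a position" and x m y e
    assume B: "gpath q [x, m, y]" "touched q e x" "touched q e y" "e \<noteq> Green"
    have b: "3 * (4 * k - 2) + 2 + (if e = e then 0 else 1) \<le> 2 * (?n - 3)"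
      using k by simp
    have "poor ?N (4 * k - 2) q"
      using k by (intro poor_all) simp
    then show "wins ?N (?n - 3) q"
      by (rule poorD[OF _ B(1) _ _ _ _ _ _ b]) (use B k in simp_all)
  next
    fix q :: "'a position" and x m y
    assume B: "gpath q [x, m, y]"
    show "wins ?N (?n - 2) q"
      \<comment> \<open>The requirement \<open>r + 9 \<le> n\<close> reads
        \<open>4k + 7 \<le> 6k - 1\<close>, that is, \<open>k \<ge> 4\<close>.\<close>
      by (rule green_path_wins[OF B, of _ "4 * k - 2"]) (use k in simp_all)
  }
qed (use k in auto)

section \<open>From positions to the game\<close>

text \<open>A position grows at its head and orients its edges, a history grows at its end and
  stores vertex sets; hence the reversal and the unordered pairs.\<close>

definition hist :: "nat position \<Rightarrow> history" where
  "hist p = rev (map (\<lambda>(u, v, c). ({u, v}, c)) p)"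

lemma hist_Cons [simp]: "hist ((u, v, c) # p) = hist p @ [({u, v}, c)]"
  by (simp add: hist_def)

lemma mem_hist: "(e, c) \<in> set (hist p) \<longleftrightarrow> (\<exists>u v. (u, v, c) \<in> set p \<and> e = {u, v})"
  by (force simp: hist_def)

lemma builder_won_gcycle:
  assumes "gcycle N p" "0 < N"
  shows "builder_won G1 G2 (cycle_graph N) (hist p)"
proof -
  obtain xs where xs: "gpath p xs" "length xs = N" "green p (last xs) (hd xs)"
    using assms by (auto simp: gcycle_def)
  have *: "({u, v}, Green) \<in> set (hist p)" if "green p u v" for u v
    using that by (auto simp: green_def mem_hist insert_commute)
  have "{xs ! i, xs ! (Suc i mod N)} \<in> color_class (hist p) Green" if "i < N" for i
  proof (cases "Suc i < N")
    case True
    then have "green p (xs ! i) (xs ! Suc i)"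
      using xs by (auto simp: gpath_def successively_conv_nth)
    then show ?thesis
      using True by (simp add: color_class_def *)
  next
    case False
    then have "Suc i = N" using that by simp
    moreover have "xs \<noteq> []" using xs(2) assms(2) by auto
    ultimately have "last xs = xs ! i" "hd xs = xs ! 0"
      using xs(2) by (auto simp: last_conv_nth hd_conv_nth)
    then have "green p (xs ! i) (xs ! 0)"
      using xs(3) by simp
    then show ?thesis
      using \<open>Suc i = N\<close> by (simp add: color_class_def *)
  qed
  moreover have "inj_on ((!) xs) {..<N}"
    using xs by (auto simp: gpath_def inj_on_nth)
  ultimately have "contains_copy (color_class (hist p) Green) (cycle_graph N)"
    unfolding contains_copy_def cycle_graph_def by (intro exI[of _ "(!) xs"]) auto
  then show ?thesis
    by (simp add: builder_won_def)
qed

lemma contains_P3: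
  assumes "{x, y} \<in> E" "{y, z} \<in> E" "x \<noteq> y" "y \<noteq> z" "x \<noteq> z"
  shows "contains_copy E (path_graph 3)"
proof -
  let ?f = "(!) [x, y, z]"
  have "i = 0 \<or> i = 1" if "Suc i < 3" for i
    using that by auto
  then have "?f ` {i, Suc i} \<in> E" if "Suc i < 3" for i
    using assms that by fastforce
  moreover have "inj_on ?f {..<3}"
    using assms by (intro inj_on_nth) auto
  ultimately show ?thesis
    unfolding contains_copy_def path_graph_def by (intro exI[of _ ?f]) auto
qed

text \<open>These are the answers left out of \<open>wins\<close>. The older edge of colour
  \<open>c\<close> is no loop, and freeness of \<open>u v\<close> keeps it from being the new edge,
  so the two span three distinct vertices.\<close>

lemma builder_won_touched:
  assumes "\<forall>(u, v, c) \<in> set p. u \<noteq> v" "u \<noteq> v" "free p u v" "c \<noteq> Green" "touched p c u \<or> touched p c v"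
  shows "builder_won (path_graph 3) (path_graph 3) G (hist ((u, v, c) # p))"
proof -
  let ?E = "color_class (hist ((u, v, c) # p)) c"
  have *: "contains_copy ?E (path_graph 3)"
    if t: "touched p c a" and ab: "{a, b} = {u, v}" "a \<noteq> b" for a b
  proof -
    obtain x where x: "(a, x, c) \<in> set p \<or> (x, a, c) \<in> set p"
      using t by (auto simp: touched_def)
    then have "{x, a} \<in> ?E"
      by (auto simp: color_class_def mem_hist insert_commute)
    moreover have "{a, b} \<in> ?E"
      by (simp add: color_class_def ab)
    moreover have "x \<noteq> a"
      using x assms(1) by auto
    moreover have "x \<noteq> b"
      using x assms(3) ab(1) by (auto simp: free_def doubleton_eq_iff)
    ultimately show ?thesis
      using ab(2) by (intro contains_P3)
  qed
  have "contains_copy ?E (path_graph 3)"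
    using assms(2,5) *[of u v] *[of v u] by (auto simp: insert_commute)
  then show ?thesis
    using assms(4) by (cases c) (auto simp: builder_won_def)
qed

lemma legal_move_exists: "\<exists>e. legal_move h e"
proof -
  have "inj (\<lambda>i. {0, Suc i})"
    by (auto simp: inj_def doubleton_eq_iff)
  then have "infinite (range (\<lambda>i. {0, Suc i}))"
    by (simp add: finite_image_iff)
  then have "\<not> range (\<lambda>i. {0, Suc i}) \<subseteq> fst ` set h"
    using finite_subset by blast
  then obtain i where "{0, Suc i} \<notin> fst ` set h"
    by auto
  then show ?thesis
    unfolding legal_move_def by (metis nat.distinct(1))
qed

lemma builder_can_win_within_wins:
  assumes "wins N T ([] :: nat position)" "0 < N"
  shows "builder_can_win_within (path_graph 3) (path_graph 3) (cycle_graph N) T"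
proof -
  let ?won = "builder_won (path_graph 3) (path_graph 3) (cycle_graph N)"
  \<comment> \<open>A strategy sees only the history, so the invariant asks for some position that
    represents it and is won in the remaining moves.\<close>
  define good where "good h \<longleftrightarrow>
    (\<exists>p. hist p = h \<and> (\<forall>(u, v, c) \<in> set p. u \<noteq> v) \<and> wins N (T - length h) p)" for h
  \<comment> \<open>Legality is claimed for every history, the invariant only where it can be kept;
    elsewhere any undrawn edge serves. This makes the choice of \<open>\<sigma>\<close>
    total.\<close>
  have ex: "\<exists>e. legal_move h e \<and>
      (good h \<and> \<not> ?won h \<and> length h < T \<longrightarrow> (\<forall>c. good (h @ [(e, c)]) \<or> ?won (h @ [(e, c)])))" for h
  proof (cases "good h \<and> \<not> ?won h \<and> length h < T")
    case True
    then obtain p where p: "hist p = h" "\<forall>(u, v, c) \<in> set p. u \<noteq> v" "wins N (T - length h) p"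
      by (auto simp: good_def)
    obtain m where m: "T - length h = Suc m"
      using True by (metis Suc_diff_Suc)
    have "\<not> gcycle N p"
      using True p builder_won_gcycle[OF _ assms(2)] by blast
    then obtain u v where uv: "u \<noteq> v" "free p u v"
      "\<And>c. (c \<noteq> Green \<longrightarrow> \<not> touched p c u \<and> \<not> touched p c v) \<Longrightarrow> wins N m ((u, v, c) # p)"
      using p(3) m by (auto simp: wins.simps)
    have "legal_move h {u, v}"
      using uv(1,2) p(1) by (fastforce simp: legal_move_def free_def mem_hist doubleton_eq_iff)
    moreover have "good (h @ [({u, v}, c)]) \<or> ?won (h @ [({u, v}, c)])" for c
    proof (cases "c \<noteq> Green \<longrightarrow> \<not> touched p c u \<and> \<not> touched p c v")
      case True
      have "T - length (h @ [({u, v}, c)]) = m"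
        using m by simp
      then have "good (h @ [({u, v}, c)])"
        unfolding good_def using p uv(1) uv(3)[OF True] by (intro exI[of _ "(u, v, c) # p"]) auto
      then show ?thesis ..
    next
      case False
      then show ?thesis
        using builder_won_touched[OF p(2) uv(1,2), of c "cycle_graph N"] p(1) by auto
    qed
    ultimately show ?thesis by blast
  next
    case False
    then show ?thesis using legal_move_exists by blast
  qed
  define \<sigma> where "\<sigma> h = (SOME e. legal_move h e \<and>
      (good h \<and> \<not> ?won h \<and> length h < T \<longrightarrow> (\<forall>c. good (h @ [(e, c)]) \<or> ?won (h @ [(e, c)]))))" for h
  have "legal_move h (\<sigma> h) \<and> (good h \<and> \<not> ?won h \<and> length h < T \<longrightarrow>
      (\<forall>c. good (h @ [(\<sigma> h, c)]) \<or> ?won (h @ [(\<sigma> h, c)])))" for h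
    unfolding \<sigma>_def by (rule someI_ex[OF ex])
  then have \<sigma>: "legal_move h (\<sigma> h)"
    "good h \<Longrightarrow> \<not> ?won h \<Longrightarrow> length h < T \<Longrightarrow> good (h @ [(\<sigma> h, c)]) \<or> ?won (h @ [(\<sigma> h, c)])" for h c
    by blast+
  have "\<exists>m\<le>T. ?won (play \<sigma> \<tau> m)" for \<tau>
  proof -
    have len: "length (play \<sigma> \<tau> m) = m" for m
      by (induction m) (auto simp: Let_def)
    have inv: "(\<exists>m'\<le>m. ?won (play \<sigma> \<tau> m')) \<or> good (play \<sigma> \<tau> m)" if "m \<le> T" for m
      using that
    proof (induction m)
      case 0
      show ?case
        using assms(1) by (auto simp: good_def hist_def)
    next
      case (Suc m)
      show ?case
      proof (cases "\<exists>m'\<le>m. ?won (play \<sigma> \<tau> m')")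
        case True
        then show ?thesis using le_SucI by blast
      next
        case False
        then have "good (play \<sigma> \<tau> m)" "\<not> ?won (play \<sigma> \<tau> m)"
          using Suc by auto
        then have "good (play \<sigma> \<tau> (Suc m)) \<or> ?won (play \<sigma> \<tau> (Suc m))"
          using \<sigma>(2)[of "play \<sigma> \<tau> m"] Suc.prems by (simp add: Let_def len)
        then show ?thesis by blast
      qed
    qed
    have "?won (play \<sigma> \<tau> T)" if g: "good (play \<sigma> \<tau> T)"
    proof -
      obtain p where "hist p = play \<sigma> \<tau> T" "gcycle N p"
        using g by (auto simp: good_def len wins.simps)
      then show ?thesis
        using builder_won_gcycle[OF _ assms(2), of p] by metis
    qed
    then show ?thesis
      using inv[of T] by auto
  qed
  then show ?thesis
    unfolding builder_can_win_within_def legal_builder_def using \<sigma>(1) by blast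
qed

theorem theorem4p11:
  fixes k :: nat
  assumes "k \<ge> 4"
  shows "online_ramsey3 (path_graph 3) (path_graph 3) (cycle_graph (4 * k)) \<le> enat (6 * k + 1)"
proof -
  have "builder_can_win_within (path_graph 3) (path_graph 3) (cycle_graph (4 * k)) (6 * k + 1)"
    using assms by (intro builder_can_win_within_wins wins_from_start) auto
  then show ?thesis
    unfolding online_ramsey3_def by (intro Inf_lower) auto
qed

end
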